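(* Each $\sigma$-compact locally compact abelian topological group is topologically isomorphic to a subgroup (with the subspace topology) of a duoseparable abelian-by-countable locally compact topological group.
   Context: A topological group $G$ is duoseparable if it contains a countable subset $S$ such that $G=SUS$ for every neighborhood $U\subseteq G$ of the unit, where $AB=\{ab:a\in A,\ b\in B\}$. A topological group $G$ is abelian-by-countable if it contains a closed normal abelian subgroup $H$ such that the quotient group $G/H$ is countable. *)

theory Defs
  imports "HOL-Analysis.Analysis" "HOL-Algebra.Coset"
begin

locale topological_group = group G for G (structure) +
  fixes T :: "'a topology"
  assumes topspace_eq_carrier: "topspace T = carrier G"
    and continuous_mult: "continuous_map (prod_topology T T) T (\<lambda>(x, y). x \<otimes> y)"
    and continuous_inv: "continuous_map T T (\<lambda>x. inv x)"

text \<open>Hausdorffness is not part of the notion of a topological group used here.\<close>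

definition sigma_compact_space :: "'a topology \<Rightarrow> bool" where
  "sigma_compact_space T \<longleftrightarrow>
     (\<exists>\<K>. countable \<K> \<and> (\<forall>K\<in>\<K>. compactin T K) \<and> \<Union>\<K> = topspace T)"

definition unit_neighborhood :: "('a, 'b) monoid_scheme \<Rightarrow> 'a topology \<Rightarrow> 'a set \<Rightarrow> bool" where
  "unit_neighborhood G T U \<longleftrightarrow>
     U \<subseteq> carrier G \<and> (\<exists>V. openin T V \<and> \<one>\<^bsub>G\<^esub> \<in> V \<and> V \<subseteq> U)"

definition duoseparable :: "('a, 'b) monoid_scheme \<Rightarrow> 'a topology \<Rightarrow> bool" where
  "duoseparable G T \<longleftrightarrow>
     (\<exists>S. S \<subseteq> carrier G \<and> countable S \<and>
       (\<forall>U. unit_neighborhood G T U \<longrightarrow> carrier G = S <#>\<^bsub>G\<^esub> U <#>\<^bsub>G\<^esub> S))"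

definition abelian_by_countable :: "('a, 'b) monoid_scheme \<Rightarrow> 'a topology \<Rightarrow> bool" where
  "abelian_by_countable G T \<longleftrightarrow>
     (\<exists>H. closedin T H \<and> H \<lhd> G \<and> comm_group (G\<lparr>carrier := H\<rparr>) \<and>
       countable (carrier (G Mod H)))"

definition topologically_isomorphic ::
  "('a, 'c) monoid_scheme \<Rightarrow> 'a topology \<Rightarrow> ('b, 'd) monoid_scheme \<Rightarrow> 'b topology \<Rightarrow> bool" where
  "topologically_isomorphic G T G' T' \<longleftrightarrow>
     (\<exists>f. f \<in> iso G G' \<and> homeomorphic_map T T' f)"

text \<open>
  HOL cannot quantify existentially over types, so the carrier of a group whose existence is
  asserted has to live in a type fixed in advance.  The following type, of cardinality
  \<open>2 ^ (2 ^ (|'a| + \<aleph>\<^sub>0))\<close>, serves only as a supply of sufficiently many points;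
  by transport of structure every group of at most this cardinality has a topologically
  isomorphic copy in it.
\<close>

type_synonym 'a points = "('a + nat) set set"

end

theory Submission
  imports Defs "HOL-Algebra.Generated_Groups"
begin

text \<open>
  Let \<open>G\<close> be the given group. It has a compact subgroup \<open>K\<close> with \<open>M = G/K\<close> separable, and a
  torsion-free subgroup \<open>D\<close> that meets every compact set in a finite set and is cocompact in an open
  subgroup \<open>G\<^sub>0\<close>; so \<open>A = G/D\<close> has the compact open subgroup \<open>C = G\<^sub>0/D\<close>. As \<open>K \<inter> D = 1\<close>, the group
  \<open>G\<close> embeds into \<open>M \<times> A\<close>, hence into \<open>H = M \<times> A'\<close>, where \<open>A'\<close> is the restricted power of \<open>A\<close>
  consisting of the sequences with almost all terms in \<open>C\<close>. The countable discrete group \<open>Q\<close> of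
  elementary matrices over the integers acts on \<open>A'\<close>, and \<open>E = H \<rtimes> Q\<close> is duoseparable: given
  \<open>x \<in> C\<^sup>\<nat>\<close> and a neighborhood \<open>V\<close> of the unit, by compactness every infinite set of indices contains
  \<open>i \<noteq> j\<close> with \<open>x\<^sub>i x\<^sub>j\<inverse> \<in> V\<close>, and transvections move this quotient into any given coordinate,
  so some \<open>q \<in> Q\<close> maps \<open>x\<close> into a prescribed neighborhood of the unit.
\<close>

section \<open>Topological groups and their quotients\<close>

text \<open>Two quotients are taken because the two mechanisms behind duoseparability need different
  inputs. Countably many translations bring every element close to the unit only in a separable
  group, hence \<open>M\<close>. Automorphisms of a power push a sequence towards the unit only if
  its terms lie in a compact group, hence \<open>A\<close> with its compact open \<open>C\<close>.
  In general \<open>G\<close> offers neither. The pigeonhole needs infinitely many coordinates, and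
  an infinite power of a noncompact \<open>A\<close> is not locally compact, hence the restriction
  to almost all terms in \<open>C\<close>. Torsion-freeness of \<open>D\<close> forces
  \<open>K \<inter> D = 1\<close>, because a compact \<open>K\<close> meets \<open>D\<close> in a
  finite group. Instead of quoting structure theory, \<open>D\<close> is built one generator at a
  time: modulo the current \<open>D\<close>, the powers of a new generator either meet every compact
  set only finitely often, and then the generator joins \<open>D\<close>, or all stay in one compact
  set, which is absorbed into the compact part. Since \<open>G\<close> may fail to be Hausdorff,
  compact sets need not be closed. So \<open>K\<close> is constructed to be closed, and closedness
  of \<open>D\<close> is derived when \<open>G\<close> is Hausdorff, to make the larger group
  Hausdorff too.\<close>

lemma openin_prod_topologyE:
  assumes "openin (prod_topology X Y) S" "(x, y) \<in> S"
  obtains U V where "openin X U" "openin Y V" "x \<in> U" "y \<in> V" "U \<times> V \<subseteq> S"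
  using assms(1)[unfolded openin_prod_topology_alt, rule_format, OF assms(2)]
  by (elim exE conjE) (rule that)

context topological_group
begin

lemma continuous_map_mult:
  assumes "continuous_map X T f" "continuous_map X T g"
  shows "continuous_map X T (\<lambda>x. f x \<otimes> g x)"
proof -
  have "continuous_map X (prod_topology T T) (\<lambda>x. (f x, g x))"
    by (simp add: continuous_map_paired assms)
  from continuous_map_compose[OF this continuous_mult] show ?thesis
    by (simp add: o_def)
qed

lemma continuous_map_m_inv:
  assumes "continuous_map X T f"
  shows "continuous_map X T (\<lambda>x. inv f x)"
  using continuous_map_compose[OF assms continuous_inv] by (simp add: o_def)

lemma openin_subset_carrier: "openin T V \<Longrightarrow> V \<subseteq> carrier G"
  using openin_subset topspace_eq_carrier by blast

lemma compactin_subset_carrier: "compactin T C \<Longrightarrow> C \<subseteq> carrier G"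
  using compactin_subset_topspace topspace_eq_carrier by blast

lemma openin_preimage_l_mult:
  assumes "openin T V" "a \<in> carrier G"
  shows "openin T {x \<in> carrier G. a \<otimes> x \<in> V}"
proof -
  have "continuous_map T T (\<lambda>x. a \<otimes> x)"
    by (rule continuous_map_mult) (auto simp: assms topspace_eq_carrier)
  from openin_continuous_map_preimage[OF this assms(1)] show ?thesis
    by (simp add: topspace_eq_carrier)
qed

lemma openin_preimage_r_mult:
  assumes "openin T V" "a \<in> carrier G"
  shows "openin T {x \<in> carrier G. x \<otimes> a \<in> V}"
proof -
  have "continuous_map T T (\<lambda>x. x \<otimes> a)"
    by (rule continuous_map_mult) (auto simp: assms topspace_eq_carrier)
  from openin_continuous_map_preimage[OF this assms(1)] show ?thesis
    by (simp add: topspace_eq_carrier)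
qed

lemma openin_set_mult_right:
  assumes "openin T V" "A \<subseteq> carrier G"
  shows "openin T (A <#> V)"
proof -
  have "A <#> V = (\<Union>a\<in>A. {x \<in> carrier G. inv a \<otimes> x \<in> V})"
  proof (intro equalityI subsetI)
    fix z assume "z \<in> A <#> V"
    then obtain a v where av: "a \<in> A" "v \<in> V" "z = a \<otimes> v" by (auto simp: set_mult_def)
    have "v \<in> carrier G" "a \<in> carrier G" using av assms openin_subset_carrier by blast+
    with av have "inv a \<otimes> z \<in> V" "z \<in> carrier G" by (auto simp: m_assoc[symmetric])
    with av show "z \<in> (\<Union>a\<in>A. {x \<in> carrier G. inv a \<otimes> x \<in> V})" by blast
  next
    fix z assume "z \<in> (\<Union>a\<in>A. {x \<in> carrier G. inv a \<otimes> x \<in> V})"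
    then obtain a where a: "a \<in> A" "z \<in> carrier G" "inv a \<otimes> z \<in> V" by blast
    then have "z = a \<otimes> (inv a \<otimes> z)" using assms by (auto simp: m_assoc[symmetric])
    with a show "z \<in> A <#> V" unfolding set_mult_def by blast
  qed
  moreover have "openin T \<dots>"
    using assms by (intro openin_clauses) (auto intro: openin_preimage_l_mult)
  ultimately show ?thesis by simp
qed

lemma compactin_set_mult:
  assumes "compactin T A" "compactin T B"
  shows "compactin T (A <#> B)"
proof -
  have "compactin (prod_topology T T) (A \<times> B)"
    using assms by (simp add: compactin_Times)
  from image_compactin[OF this continuous_mult] have "compactin T ((\<lambda>(x, y). x \<otimes> y) ` (A \<times> B))" .
  moreover have "(\<lambda>(x, y). x \<otimes> y) ` (A \<times> B) = A <#> B"
    by (auto simp: set_mult_def image_def)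
  ultimately show ?thesis by simp
qed

lemma compactin_inv: "compactin T A \<Longrightarrow> compactin T ((\<lambda>x. inv x) ` A)"
  by (rule image_compactin[OF _ continuous_inv])

text \<open>Continuity of the product at \<open>(\<one>, \<one>)\<close> yields \<open>U\<close>;
  keeping only the points whose inverse is also in \<open>U\<close> adds symmetry. This plays the
  role of halving an epsilon.\<close>

lemma small_unit_neighborhood:
  assumes "openin T V" "\<one> \<in> V"
  obtains W where "openin T W" "\<one> \<in> W" "W \<subseteq> V"
    "\<And>x. x \<in> W \<Longrightarrow> inv x \<in> W" "\<And>x y. \<lbrakk>x \<in> W; y \<in> W\<rbrakk> \<Longrightarrow> x \<otimes> y \<in> V"
proof -
  have "openin (prod_topology T T) {z \<in> topspace (prod_topology T T). (\<lambda>(x, y). x \<otimes> y) z \<in> V}"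
    by (rule openin_continuous_map_preimage[OF continuous_mult assms(1)])
  moreover have "(\<one>, \<one>) \<in> {z \<in> topspace (prod_topology T T). (\<lambda>(x, y). x \<otimes> y) z \<in> V}"
    using assms by (simp add: topspace_eq_carrier)
  ultimately obtain A B where AB: "openin T A" "openin T B" "\<one> \<in> A" "\<one> \<in> B"
    "A \<times> B \<subseteq> {z \<in> topspace (prod_topology T T). (\<lambda>(x, y). x \<otimes> y) z \<in> V}"
    by (rule openin_prod_topologyE)
  define U where "U = A \<inter> B \<inter> V"
  have U: "openin T U" "\<one> \<in> U" "U \<subseteq> V" using AB assms by (auto simp: U_def)
  have Uc: "U \<subseteq> carrier G" using U openin_subset_carrier by blast
  have Um: "x \<otimes> y \<in> V" if "x \<in> U" "y \<in> U" for x y using that AB(5) by (auto simp: U_def)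
  define W where "W = U \<inter> {x \<in> carrier G. inv x \<in> U}"
  have "openin T {x \<in> carrier G. inv x \<in> U}"
    using openin_continuous_map_preimage[OF continuous_inv U(1)] by (simp add: topspace_eq_carrier)
  then show ?thesis
    using U Um Uc by (intro that[of W]) (simp_all add: W_def openin_Int subset_iff)
qed

text \<open>The translate \<open>x W\<close> is a neighborhood of \<open>x\<close>, so it contains
  some \<open>a = x w\<close> with \<open>a \<in> A\<close>, and then
  \<open>x = a \<otimes> inv w\<close>. This controls closures without separation axioms.\<close>

lemma closure_of_subset_set_mult:
  assumes "openin T W" "\<one> \<in> W" "\<And>x. x \<in> W \<Longrightarrow> inv x \<in> W" "A \<subseteq> carrier G"
  shows "T closure_of A \<subseteq> A <#> W"
proof
  fix x assume x: "x \<in> T closure_of A"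
  then have xc: "x \<in> carrier G" by (metis in_closure_of topspace_eq_carrier)
  have "openin T ({x} <#> W)" by (rule openin_set_mult_right) (use assms xc in auto)
  moreover have "x \<in> {x} <#> W" using assms(2) xc by (force simp: set_mult_def)
  ultimately obtain a where a: "a \<in> A" "a \<in> {x} <#> W" using x unfolding in_closure_of by blast
  then obtain w where w: "w \<in> W" "a = x \<otimes> w" by (auto simp: set_mult_def)
  moreover have "w \<in> carrier G" using w assms(1) openin_subset_carrier by blast
  ultimately have "x = a \<otimes> inv w" using xc by (simp add: m_assoc)
  then show "x \<in> A <#> W" using a(1) assms(3)[OF w(1)] unfolding set_mult_def by blast
qed

lemma locally_compact_spaceI_unit:
  assumes "openin T U" "compactin T C" "\<one> \<in> U" "U \<subseteq> C"
  shows "locally_compact_space T"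
  unfolding locally_compact_space_def topspace_eq_carrier
proof
  fix x assume x: "x \<in> carrier G"
  have "openin T ({x} <#> U)" "compactin T ({x} <#> C)"
    using x assms by (auto intro!: openin_set_mult_right compactin_set_mult simp: topspace_eq_carrier)
  moreover have "x \<in> {x} <#> U" using x assms(3) by (force simp: set_mult_def)
  moreover have "{x} <#> U \<subseteq> {x} <#> C" using assms(4) by (auto simp: set_mult_def)
  ultimately show "\<exists>U K. openin T U \<and> compactin T K \<and> x \<in> U \<and> U \<subseteq> K" by blast
qed

text \<open>The diagonal is the preimage of the unit under \<open>x \<otimes> inv y\<close>.\<close>

lemma Hausdorff_space_if_closed_unit:
  assumes "closedin T {\<one>}"
  shows "Hausdorff_space T"
proof -
  have "continuous_map (prod_topology T T) T (\<lambda>z. fst z \<otimes> inv (snd z))"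
    by (intro continuous_map_mult continuous_map_m_inv continuous_map_fst continuous_map_snd)
  from closedin_continuous_map_preimage[OF this assms]
  have "closedin (prod_topology T T) {z \<in> carrier G \<times> carrier G. fst z \<otimes> inv snd z = \<one>}"
    by (simp add: topspace_eq_carrier)
  moreover have "{z \<in> carrier G \<times> carrier G. fst z \<otimes> inv snd z = \<one>} = (\<lambda>x. (x, x)) ` topspace T"
    using inv_solve_right' by (fastforce simp: topspace_eq_carrier)
  ultimately show ?thesis by (simp add: Hausdorff_space_closedin_diagonal)
qed

end

section \<open>The quotient topology on the cosets of a normal subgroup\<close>

definition quotient_group_topology :: "('a, 'b) monoid_scheme \<Rightarrow> 'a topology \<Rightarrow> 'a set \<Rightarrow> 'a set topology"
  where "quotient_group_topology G T N =
    topology (\<lambda>W. W \<subseteq> carrier (G Mod N) \<and> openin T {x \<in> carrier G. N #>\<^bsub>G\<^esub> x \<in> W})"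

locale topological_group_quotient = topological_group G T + normal N G for G (structure) and T N
begin

lemma openin_quotient:
  "openin (quotient_group_topology G T N) W \<longleftrightarrow>
     W \<subseteq> carrier (G Mod N) \<and> openin T {x \<in> carrier G. N #> x \<in> W}"
proof -
  have "istopology (\<lambda>W. W \<subseteq> carrier (G Mod N) \<and> openin T {x \<in> carrier G. N #> x \<in> W})"
    unfolding istopology_def
  proof (intro conjI allI impI)
    fix U V assume a: "U \<subseteq> carrier (G Mod N) \<and> openin T {x \<in> carrier G. N #> x \<in> U}"
      "V \<subseteq> carrier (G Mod N) \<and> openin T {x \<in> carrier G. N #> x \<in> V}"
    have "{x \<in> carrier G. N #> x \<in> U \<inter> V} = {x \<in> carrier G. N #> x \<in> U} \<inter> {x \<in> carrier G. N #> x \<in> V}"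
      by auto
    with a show "openin T {x \<in> carrier G. N #> x \<in> U \<inter> V}" by (simp add: openin_Int)
  next
    fix \<K> assume a: "\<forall>K\<in>\<K>. K \<subseteq> carrier (G Mod N) \<and> openin T {x \<in> carrier G. N #> x \<in> K}"
    have "{x \<in> carrier G. N #> x \<in> \<Union>\<K>} = (\<Union>K\<in>\<K>. {x \<in> carrier G. N #> x \<in> K})" by auto
    with a show "openin T {x \<in> carrier G. N #> x \<in> \<Union>\<K>}" by auto
  qed auto
  then show ?thesis unfolding quotient_group_topology_def by (simp add: topology_inverse')
qed

lemma topspace_quotient: "topspace (quotient_group_topology G T N) = carrier (G Mod N)"
proof -
  have "{x \<in> carrier G. N #> x \<in> carrier (G Mod N)} = topspace T"
    by (auto simp: carrier_FactGroup topspace_eq_carrier)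
  then have "openin (quotient_group_topology G T N) (carrier (G Mod N))"
    by (simp add: openin_quotient)
  then show ?thesis by (metis openin_quotient openin_subset openin_topspace subset_antisym)
qed

lemma continuous_map_coset: "continuous_map T (quotient_group_topology G T N) (\<lambda>x. N #> x)"
  unfolding continuous_map topspace_quotient topspace_eq_carrier
  by (auto simp: openin_quotient carrier_FactGroup)

lemma coset_eq_iff:
  assumes "x \<in> carrier G" "y \<in> carrier G"
  shows "N #> x = N #> y \<longleftrightarrow> (\<exists>n\<in>N. x = n \<otimes> y)"
proof
  assume "N #> x = N #> y"
  then have "x \<in> N #> y" using rcos_self[OF assms(1)] subgroup_axioms by blast
  then show "\<exists>n\<in>N. x = n \<otimes> y" by (auto simp: r_coset_def)
next
  assume "\<exists>n\<in>N. x = n \<otimes> y"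
  then show "N #> x = N #> y"
    using assms(2) subgroup_axioms by (metis repr_independence rcosI subset)
qed

text \<open>The saturation of \<open>V\<close> is \<open>N <#> V\<close>, a union of translates of
  \<open>V\<close>. Openness of the coset map is what hands continuity of the product and local
  compactness down to the quotient.\<close>

lemma openin_image_coset:
  assumes "openin T V"
  shows "openin (quotient_group_topology G T N) ((\<lambda>x. N #> x) ` V)"
proof -
  have V: "V \<subseteq> carrier G" using assms openin_subset_carrier by blast
  have "{x \<in> carrier G. N #> x \<in> (\<lambda>x. N #> x) ` V} = N <#> V"
    using V subset unfolding set_mult_def by (auto simp: coset_eq_iff subset_iff image_iff) blast+
  moreover have "openin T (N <#> V)" by (rule openin_set_mult_right[OF assms subset])
  ultimately show ?thesis using V by (auto simp: openin_quotient carrier_FactGroup)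
qed

lemma topological_group_quotient: "topological_group (G Mod N) (quotient_group_topology G T N)"
proof -
  interpret Q: group "G Mod N" by (rule factorgroup_is_group)
  let ?Q = "quotient_group_topology G T N"
  show ?thesis
  proof
    show "topspace ?Q = carrier (G Mod N)" by (rule topspace_quotient)
    have *: "\<exists>U V. openin ?Q U \<and> openin ?Q V \<and> X \<in> U \<and> Y \<in> V \<and>
        U \<times> V \<subseteq> {z \<in> carrier (G Mod N) \<times> carrier (G Mod N). fst z <#> snd z \<in> W}"
      if W: "openin ?Q W" and XY: "X \<in> carrier (G Mod N)" "Y \<in> carrier (G Mod N)" "X <#> Y \<in> W" for X Y W
    proof -
      obtain x y where x: "x \<in> carrier G" "X = N #> x" and y: "y \<in> carrier G" "Y = N #> y"
        using XY by (auto simp: carrier_FactGroup)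
      let ?O = "{z \<in> topspace (prod_topology T T). (\<lambda>(x, y). x \<otimes> y) z \<in> {x \<in> carrier G. N #> x \<in> W}}"
      have "openin (prod_topology T T) ?O"
        by (rule openin_continuous_map_preimage[OF continuous_mult]) (use W openin_quotient in blast)
      moreover have "(x, y) \<in> ?O" using x y XY by (simp add: topspace_eq_carrier rcos_sum)
      ultimately obtain U V where UV: "openin T U" "openin T V" "x \<in> U" "y \<in> V" "U \<times> V \<subseteq> ?O"
        by (rule openin_prod_topologyE)
      have c: "U \<subseteq> carrier G" "V \<subseteq> carrier G" using UV openin_subset_carrier by auto
      show ?thesis
      proof (intro exI conjI)
        show "openin ?Q ((\<lambda>x. N #> x) ` U)" "openin ?Q ((\<lambda>x. N #> x) ` V)"
          using UV openin_image_coset by auto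
        show "X \<in> (\<lambda>x. N #> x) ` U" "Y \<in> (\<lambda>x. N #> x) ` V" using UV x y by auto
        show "(\<lambda>x. N #> x) ` U \<times> (\<lambda>x. N #> x) ` V
          \<subseteq> {z \<in> carrier (G Mod N) \<times> carrier (G Mod N). fst z <#> snd z \<in> W}"
          using UV(5) c by (auto simp: carrier_FactGroup rcos_sum subset_iff)
      qed
    qed
    show "continuous_map (prod_topology ?Q ?Q) ?Q (\<lambda>(x, y). x \<otimes>\<^bsub>G Mod N\<^esub> y)"
      unfolding continuous_map
    proof (intro conjI allI impI)
      show "(\<lambda>(x, y). x \<otimes>\<^bsub>G Mod N\<^esub> y) ` topspace (prod_topology ?Q ?Q) \<subseteq> topspace ?Q"
        using Q.m_closed by (auto simp: topspace_quotient)
      fix W assume "openin ?Q W"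
      from *[OF this] show "openin (prod_topology ?Q ?Q)
          {x \<in> topspace (prod_topology ?Q ?Q). (case x of (x, y) \<Rightarrow> x \<otimes>\<^bsub>G Mod N\<^esub> y) \<in> W}"
        unfolding openin_prod_topology_alt by (auto simp: topspace_quotient case_prod_unfold)
    qed
    show "continuous_map ?Q ?Q (\<lambda>x. inv\<^bsub>G Mod N\<^esub> x)"
      unfolding continuous_map
    proof (intro conjI allI impI)
      show "(\<lambda>x. inv\<^bsub>G Mod N\<^esub> x) ` topspace ?Q \<subseteq> topspace ?Q"
        by (auto simp: topspace_quotient)
      fix W assume W: "openin ?Q W"
      have "openin T {x \<in> topspace T. inv x \<in> {x \<in> carrier G. N #> x \<in> W}}"
        by (rule openin_continuous_map_preimage[OF continuous_inv]) (use W openin_quotient in blast)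
      moreover have "{x \<in> topspace T. inv x \<in> {x \<in> carrier G. N #> x \<in> W}}
         = {x \<in> carrier G. N #> x \<in> {X \<in> carrier (G Mod N). inv\<^bsub>G Mod N\<^esub> X \<in> W}}"
        by (auto simp: topspace_eq_carrier carrier_FactGroup inv_FactGroup rcos_inv)
      ultimately show "openin ?Q {x \<in> topspace ?Q. inv\<^bsub>G Mod N\<^esub> x \<in> W}"
        by (auto simp: openin_quotient topspace_quotient)
    qed
  qed
qed

lemma locally_compact_space_quotient:
  assumes "locally_compact_space T"
  shows "locally_compact_space (quotient_group_topology G T N)"
  using assms
proof (rule locally_compact_space_continuous_open_map_image[rotated 3])
  show "continuous_map T (quotient_group_topology G T N) (\<lambda>x. N #> x)" by (rule continuous_map_coset)
  show "open_map T (quotient_group_topology G T N) (\<lambda>x. N #> x)"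
    unfolding open_map_def using openin_image_coset by blast
  show "(\<lambda>x. N #> x) ` topspace T = topspace (quotient_group_topology G T N)"
    by (simp add: topspace_quotient topspace_eq_carrier carrier_FactGroup)
qed

text \<open>A closed \<open>N\<close> makes the unit of the quotient a closed point, which suffices
  in a topological group. The quotient can thus be Hausdorff although \<open>T\<close> is
  not.\<close>

lemma Hausdorff_space_quotient:
  assumes "closedin T N"
  shows "Hausdorff_space (quotient_group_topology G T N)"
proof -
  interpret Q: topological_group "G Mod N" "quotient_group_topology G T N"
    by (rule topological_group_quotient)
  have "N #> x = N \<longleftrightarrow> x \<in> N" if "x \<in> carrier G" for x
    using that subgroup_axioms by (metis coset_join2 rcos_self)
  then have "{x \<in> carrier G. N #> x \<in> carrier (G Mod N) - {N}} = topspace T - N"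
    by (auto simp: carrier_FactGroup topspace_eq_carrier)
  then have "closedin (quotient_group_topology G T N) {N}"
    using assms Q.one_closed unfolding closedin_def openin_quotient topspace_quotient by auto
  then show ?thesis using Q.Hausdorff_space_if_closed_unit by simp
qed

end

section \<open>Compact subgroups with separable quotient\<close>

lemma set_multI: "\<lbrakk>a \<in> A; b \<in> B\<rbrakk> \<Longrightarrow> a \<otimes>\<^bsub>G\<^esub> b \<in> A <#>\<^bsub>G\<^esub> B"
  by (auto simp: set_mult_def)

lemma set_multE:
  assumes "x \<in> A <#>\<^bsub>G\<^esub> B"
  obtains a b where "a \<in> A" "b \<in> B" "x = a \<otimes>\<^bsub>G\<^esub> b"
  using assms by (auto simp: set_mult_def)

lemma (in topological_group) compact_finite_translates:
  assumes "compactin T L" "openin T V" "\<one> \<in> V"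
  obtains F where "finite F" "F \<subseteq> L" "L \<subseteq> F <#> V"
proof -
  have L: "L \<subseteq> carrier G" by (rule compactin_subset_carrier[OF assms(1)])
  have 1: "\<forall>W\<in>(\<lambda>x. {x} <#> V) ` L. openin T W"
    using openin_set_mult_right[OF assms(2)] L by auto
  have 2: "L \<subseteq> \<Union>((\<lambda>x. {x} <#> V) ` L)"
  proof
    fix x assume "x \<in> L"
    then have "x \<otimes> \<one> \<in> {x} <#> V" using assms(3) by (intro set_multI) auto
    then have "x \<in> {x} <#> V" using \<open>x \<in> L\<close> L by (metis r_one subsetD)
    with \<open>x \<in> L\<close> show "x \<in> \<Union>((\<lambda>x. {x} <#> V) ` L)" by auto
  qed
  from 1 2 assms(1) obtain \<F> where F: "finite \<F>" "\<F> \<subseteq> (\<lambda>x. {x} <#> V) ` L" "L \<subseteq> \<Union>\<F>"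
    unfolding compactin_def by meson
  then obtain F where "F \<subseteq> L" "finite F" "\<F> = (\<lambda>x. {x} <#> V) ` F"
    by (meson finite_subset_image)
  moreover from this F have "L \<subseteq> F <#> V" by (auto simp: set_mult_def)
  ultimately show ?thesis using that by blast
qed

lemma (in topological_group) sigma_compact_countable_translates:
  assumes "sigma_compact_space T" "openin T V" "\<one> \<in> V"
  obtains S where "countable S" "S \<subseteq> carrier G" "carrier G \<subseteq> S <#> V"
proof -
  obtain \<K> where "countable \<K> \<and> (\<forall>L\<in>\<K>. compactin T L) \<and> \<Union>\<K> = topspace T"
    using assms(1) unfolding sigma_compact_space_def ..
  then have K: "countable \<K>" "\<And>L. L \<in> \<K> \<Longrightarrow> compactin T L" "\<Union>\<K> = carrier G"
    unfolding topspace_eq_carrier by blast+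
  have "\<exists>F. finite F \<and> F \<subseteq> L \<and> L \<subseteq> F <#> V" if "L \<in> \<K>" for L
    by (rule compact_finite_translates[OF K(2)[OF that] assms(2,3)]) blast
  then obtain F where F: "\<And>L. L \<in> \<K> \<Longrightarrow> finite (F L) \<and> F L \<subseteq> L \<and> L \<subseteq> F L <#> V"
    by metis
  show ?thesis
  proof
    show "countable (\<Union>L\<in>\<K>. F L)" using K(1) F by (auto intro: countable_finite)
    show "(\<Union>L\<in>\<K>. F L) \<subseteq> carrier G" using F K(3) by blast
    show "carrier G \<subseteq> (\<Union>L\<in>\<K>. F L) <#> V"
    proof
      fix x assume "x \<in> carrier G"
      then obtain L where "L \<in> \<K>" "x \<in> L" using K(3) by blast
      then have "x \<in> F L <#> V" "F L <#> V \<subseteq> (\<Union>L\<in>\<K>. F L) <#> V"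
        using F by (blast, intro mono_set_mult, auto)
      then show "x \<in> (\<Union>L\<in>\<K>. F L) <#> V" by blast
    qed
  qed
qed

lemma (in topological_group) compact_unit_neighborhood:
  assumes "locally_compact_space T"
  obtains U P where "openin T U" "compactin T P" "\<one> \<in> U" "U \<subseteq> P"
  using assms unfolding locally_compact_space_def topspace_eq_carrier by (meson one_closed)

text \<open>A Kakutani-Kodaira argument: \<open>K\<close> is the intersection of a shrinking
  sequence of neighborhoods \<open>V n\<close>, and the sets \<open>K <#> V n\<close> form a base at
  the unit modulo \<open>K\<close>. Each \<open>V n\<close> needs only countably many translates to
  cover \<open>G\<close>; collecting these for all \<open>n\<close> gives \<open>S\<close>, whose
  image is dense in the quotient by \<open>K\<close>.\<close>

lemma (in topological_group) compact_subgroup_separable_quotient: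
  assumes "locally_compact_space T" "sigma_compact_space T"
  obtains K S where "subgroup K G" "compactin T K" "closedin T K" "countable S" "S \<subseteq> carrier G"
    "\<And>V. \<lbrakk>openin T V; \<one> \<in> V\<rbrakk> \<Longrightarrow> carrier G \<subseteq> S <#> (K <#> V)"
proof -
  obtain U P where UP: "openin T U" "compactin T P" "\<one> \<in> U" "U \<subseteq> P"
    by (rule compact_unit_neighborhood[OF assms(1)])
  \<comment> \<open>All \<open>V n\<close> stay inside \<open>U\<close> and so inside the compact
    \<open>P\<close>; the symmetric halving in \<open>step\<close> turns their intersection into a
    subgroup.\<close>
  define ok where "ok V \<longleftrightarrow> openin T V \<and> \<one> \<in> V \<and> V \<subseteq> U" for V
  define step where "step V W \<longleftrightarrow> W \<subseteq> V \<and> (\<forall>x\<in>W. inv x \<in> W) \<and> (\<forall>x\<in>W. \<forall>y\<in>W. x \<otimes> y \<in> V)" for V W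
  have "\<exists>V. \<forall>n::nat. ok (V n) \<and> step (V n) (V (Suc n))"
  proof (rule dependent_nat_choice)
    show "\<exists>V. ok V" using UP by (auto simp: ok_def)
    fix V assume V: "ok V"
    then obtain W where "openin T W" "\<one> \<in> W" "W \<subseteq> V"
    "\<And>x. x \<in> W \<Longrightarrow> inv x \<in> W" "\<And>x y. \<lbrakk>x \<in> W; y \<in> W\<rbrakk> \<Longrightarrow> x \<otimes> y \<in> V"
      by (metis ok_def small_unit_neighborhood)
    with V have "ok W \<and> step V W" by (auto simp: ok_def step_def)
    then show "\<exists>W. ok W \<and> step V W" ..
  qed
  then obtain V where ok: "\<And>n. ok (V n)" and step: "\<And>n. step (V n) (V (Suc n))" by blast
  have o: "openin T (V n)" "\<one> \<in> V n" "V n \<subseteq> U" for n using ok by (auto simp: ok_def)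
  have dec: "V (Suc n) \<subseteq> V n" for n using step by (auto simp: step_def)
  have antimono: "V n \<subseteq> V m" if "m \<le> n" for m n
    using that dec by (rule lift_Suc_antimono_le[rotated])
  have inv: "inv x \<in> V (Suc n)" if "x \<in> V (Suc n)" for x n using step that by (auto simp: step_def)
  have mul: "x \<otimes> y \<in> V n" if "x \<in> V (Suc n)" "y \<in> V (Suc n)" for x y n
    using step that by (auto simp: step_def)
  have Vc: "V n \<subseteq> carrier G" for n using o openin_subset_carrier by blast
  define K where "K = (\<Inter>n. V n)"
  have sub: "subgroup K G"
  proof (rule subgroupI)
    show "K \<subseteq> carrier G" using Vc by (auto simp: K_def)
    show "K \<noteq> {}" using o(2) by (auto simp: K_def)
    show "inv a \<in> K" if "a \<in> K" for a
      using that inv dec unfolding K_def by blast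
    show "a \<otimes> b \<in> K" if "a \<in> K" "b \<in> K" for a b
      using that mul unfolding K_def by blast
  qed
  \<comment> \<open>A closure costs one index only, so \<open>K\<close> is also the intersection of
    the closures and therefore closed.\<close>
  have cl: "T closure_of (V (Suc n)) \<subseteq> V n" for n
    using closure_of_subset_set_mult[OF o(1,2) inv Vc] mul by (force elim: set_multE)
  have "K = (\<Inter>n. T closure_of (V n))"
  proof
    show "K \<subseteq> (\<Inter>n. T closure_of (V n))"
      using closure_of_subset Vc unfolding K_def topspace_eq_carrier[symmetric] by fastforce
    show "(\<Inter>n. T closure_of (V n)) \<subseteq> K" using cl unfolding K_def by blast
  qed
  then have closed: "closedin T K" by auto
  have "K \<subseteq> P" using o(3)[of 0] UP(4) by (auto simp: K_def)
  then have comp: "compactin T K" using closed_compactin[OF UP(2) _ closed] by blast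
  have "\<exists>S. countable S \<and> S \<subseteq> carrier G \<and> carrier G \<subseteq> S <#> V n" for n
    using sigma_compact_countable_translates[OF assms(2) o(1,2)] by metis
  then obtain S where S: "\<And>n. countable (S n) \<and> S n \<subseteq> carrier G \<and> carrier G \<subseteq> S n <#> V n"
    by metis
  have small: "\<exists>n. V n \<subseteq> K <#> W" if W: "openin T W" "\<one> \<in> W" for W
  proof -
    \<comment> \<open>A point outside \<open>K\<close> misses some closure, so this family covers
      \<open>P\<close>. A finite subcover uses finitely many \<open>n\<close>; for \<open>m\<close>
      above all of them \<open>V m\<close> avoids the complements, and only \<open>K <#> W\<close>
      is left to contain it.\<close>
    let ?\<U> = "insert (K <#> W) (range (\<lambda>n. topspace T - T closure_of (V n)))"
    have KW: "openin T (K <#> W)" using W sub by (intro openin_set_mult_right) (auto dest: subgroup.subset)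
    have "K \<subseteq> K <#> W"
    proof
      fix k assume "k \<in> K"
      then have "k \<otimes> \<one> \<in> K <#> W" using W by (intro set_multI)
      then show "k \<in> K <#> W" using \<open>k \<in> K\<close> sub by (metis r_one subgroup.mem_carrier)
    qed
    then have "P \<subseteq> \<Union>?\<U>"
      using \<open>K = (\<Inter>n. T closure_of (V n))\<close> compactin_subset_topspace[OF UP(2)] by auto
    moreover have "\<forall>A\<in>?\<U>. openin T A" using KW by auto
    ultimately obtain \<F> where F: "finite \<F>" "\<F> \<subseteq> ?\<U>" "P \<subseteq> \<Union>\<F>"
      using UP(2) unfolding compactin_def by meson
    have "finite (\<F> - {K <#> W})" "\<F> - {K <#> W} \<subseteq> range (\<lambda>n. topspace T - T closure_of (V n))"
      using F by auto
    then obtain N where N: "finite N" "\<F> - {K <#> W} = (\<lambda>n. topspace T - T closure_of (V n)) ` N"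
      by (meson finite_subset_image)
    obtain m where m: "\<And>n. n \<in> N \<Longrightarrow> n \<le> m" using N(1) finite_nat_set_iff_bounded_le by auto
    have "V m \<subseteq> K <#> W"
    proof
      fix x assume x: "x \<in> V m"
      have "x \<notin> topspace T - T closure_of (V n)" if "n \<in> N" for n
        using x antimono[OF m[OF that]] closure_of_subset Vc[of n] unfolding topspace_eq_carrier[symmetric]
        by blast
      moreover have "x \<in> \<Union>\<F>" using x o(3) UP(4) F(3) by blast
      ultimately show "x \<in> K <#> W" using N(2) by blast
    qed
    then show ?thesis ..
  qed
  show ?thesis
  proof
    show "carrier G \<subseteq> (\<Union>n. S n) <#> (K <#> W)" if W: "openin T W" "\<one> \<in> W" for W
    proof -
      obtain n where "V n \<subseteq> K <#> W" using small[OF W] by blast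
      then have "S n <#> V n \<subseteq> (\<Union>n. S n) <#> (K <#> W)" by (intro mono_set_mult) auto
      with S show ?thesis by blast
    qed
  qed (use S sub comp closed in auto)
qed

locale topological_comm_group = topological_group G T + comm_group G for G (structure) and T

text \<open>Closeness in the quotient by \<open>D\<close>, phrased without passing to cosets.\<close>

definition near :: "('a, 'b) monoid_scheme \<Rightarrow> 'a set \<Rightarrow> 'a set \<Rightarrow> 'a \<Rightarrow> 'a \<Rightarrow> bool" where
  "near G V D x y \<longleftrightarrow> (\<exists>v\<in>V. \<exists>\<delta>\<in>D. x = y \<otimes>\<^bsub>G\<^esub> v \<otimes>\<^bsub>G\<^esub> \<delta>)"

context comm_group
begin

lemma near_sym:
  assumes "near G V D x y" "V \<subseteq> carrier G" "\<And>x. x \<in> V \<Longrightarrow> inv x \<in> V" "subgroup D G" "y \<in> carrier G"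
  shows "near G V D y x"
proof -
  obtain v \<delta> where v: "v \<in> V" "\<delta> \<in> D" "x = y \<otimes> v \<otimes> \<delta>" using assms(1) by (auto simp: near_def)
  have c: "v \<in> carrier G" "\<delta> \<in> carrier G" using v assms subgroup.subset by blast+
  have "x \<otimes> inv v \<otimes> inv \<delta> = y" unfolding v(3) using c assms(5)
    by (metis inv_solve_right' m_assoc m_closed m_comm)
  then show ?thesis unfolding near_def using v assms subgroup.m_inv_closed by metis
qed

lemma near_trans:
  assumes "near G W D x y" "near G W D y z" "W \<subseteq> carrier G" "\<And>x y. \<lbrakk>x \<in> W; y \<in> W\<rbrakk> \<Longrightarrow> x \<otimes> y \<in> V"
    "subgroup D G" "z \<in> carrier G"
  shows "near G V D x z"
proof -
  obtain v \<delta> v' \<delta>' where v: "v \<in> W" "\<delta> \<in> D" "x = y \<otimes> v \<otimes> \<delta>" "v' \<in> W" "\<delta>' \<in> D" "y = z \<otimes> v' \<otimes> \<delta>'"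
    using assms(1,2) by (auto simp: near_def)
  have c: "v \<in> carrier G" "\<delta> \<in> carrier G" "v' \<in> carrier G" "\<delta>' \<in> carrier G"
    using v assms subgroup.subset by blast+
  have "x = z \<otimes> (v \<otimes> v') \<otimes> (\<delta> \<otimes> \<delta>')" unfolding v(3,6) using c assms(6) by (simp add: m_ac)
  then show ?thesis unfolding near_def using v assms subgroup.m_closed by metis
qed

lemma near_mult:
  assumes "near G V D x y" "V \<subseteq> carrier G" "subgroup D G" "y \<in> carrier G" "a \<in> carrier G"
  shows "near G V D (a \<otimes> x) (a \<otimes> y)"
proof -
  obtain v \<delta> where v: "v \<in> V" "\<delta> \<in> D" "x = y \<otimes> v \<otimes> \<delta>" using assms(1) by (auto simp: near_def)
  have c: "v \<in> carrier G" "\<delta> \<in> carrier G" using v assms subgroup.subset by blast+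
  have "a \<otimes> x = a \<otimes> y \<otimes> v \<otimes> \<delta>" unfolding v(3) using c assms by (simp add: m_ac)
  then show ?thesis unfolding near_def using v by metis
qed

lemma near_int_pow_shift:
  assumes "near G V D (d [^] (m::int)) (d [^] (n::int))" "V \<subseteq> carrier G" "subgroup D G" "d \<in> carrier G"
  shows "near G V D (d [^] (m + k)) (d [^] (n + k))"
  using near_mult[OF assms(1-3), of "d [^] k"] assms(4)
  by (simp add: int_pow_mult m_comm)

end

section \<open>Discrete cocompact subgroups\<close>

context topological_comm_group
begin

text \<open>Finitely many translates of a small \<open>W\<close> cover \<open>C\<close>, so
  infinitely many powers of \<open>d\<close> fall into the same translate modulo \<open>D\<close>.
  The quotient of two of them is a power close to the unit modulo \<open>D\<close>, with exponent as
  large as desired.\<close>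

lemma int_pow_recurrence:
  assumes D: "subgroup D G" and d: "d \<in> carrier G" and C: "compactin T C"
    and inf: "infinite {n::int. d [^] n \<in> C <#> D}"
    and V: "openin T V" "\<one> \<in> V"
  shows "\<exists>n>m. near G V D (d [^] (n::int)) \<one>"
proof -
  obtain W where W: "openin T W" "\<one> \<in> W" "W \<subseteq> V" "\<And>x. x \<in> W \<Longrightarrow> inv x \<in> W"
    "\<And>x y. \<lbrakk>x \<in> W; y \<in> W\<rbrakk> \<Longrightarrow> x \<otimes> y \<in> V"
    using small_unit_neighborhood[OF V] by metis
  have Wc: "W \<subseteq> carrier G" and Vc: "V \<subseteq> carrier G" using W V openin_subset_carrier by auto
  obtain F where F: "finite F" "F \<subseteq> C" "C \<subseteq> F <#> W"
    by (rule compact_finite_translates[OF C W(1,2)])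
  have Fc: "F \<subseteq> carrier G" using F C compactin_subset_carrier by blast
  have "\<exists>f\<in>F. near G W D (d [^] n) f" if n: "d [^] n \<in> C <#> D" for n :: int
  proof -
    obtain c \<delta> where c: "c \<in> C" "\<delta> \<in> D" "d [^] n = c \<otimes> \<delta>" by (rule set_multE[OF n])
    then obtain f w where "f \<in> F" "w \<in> W" "c = f \<otimes> w" using F by (blast elim: set_multE)
    with c show ?thesis unfolding near_def by blast
  qed
  then obtain f where f: "\<And>n::int. d [^] n \<in> C <#> D \<Longrightarrow> f n \<in> F \<and> near G W D (d [^] n) (f n)"
    by metis
  have "finite (f ` {n::int. d [^] n \<in> C <#> D})"
    using F(1) f by (auto intro: finite_subset)
  from pigeonhole_infinite[OF inf this] obtain n0 :: int
    where n0: "d [^] n0 \<in> C <#> D" "infinite {a \<in> {n::int. d [^] n \<in> C <#> D}. f a = f n0}"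
    by auto
  \<comment> \<open>An infinite class does not fit into a bounded window, so some \<open>n\<close>
    in it differs from \<open>n0\<close> by more than \<open>\<bar>m\<bar>\<close>. Its side of
    \<open>n0\<close> is unknown, hence both differences are treated below.\<close>
  have "\<not> {a \<in> {n::int. d [^] n \<in> C <#> D}. f a = f n0} \<subseteq> {n0 - \<bar>m\<bar>..n0 + \<bar>m\<bar>}"
    using n0(2) finite_subset by blast
  then obtain n where n: "d [^] n \<in> C <#> D" "f n = f n0" "n < n0 - \<bar>m\<bar> \<or> n > n0 + \<bar>m\<bar>" by fastforce
  have *: "near G V D (d [^] i) (d [^] j)"
    if "d [^] i \<in> C <#> D" "d [^] j \<in> C <#> D" "f i = f j" for i j :: int
  proof (rule near_trans[OF _ _ Wc W(5) D])
    show "near G W D (d [^] i) (f i)" using f that by blast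
    show "near G W D (f i) (d [^] j)"
      using near_sym[OF _ Wc W(4) D] f[OF that(2)] Fc that(3) by auto
  qed (use d in auto)
  have "near G V D (d [^] (i - j)) \<one>"
    if "d [^] i \<in> C <#> D" "d [^] j \<in> C <#> D" "f i = f j" for i j :: int
    using near_int_pow_shift[OF *[OF that] Vc D d, of "- j"] by simp
  then have "near G V D (d [^] (n - n0)) \<one>" "near G V D (d [^] (n0 - n)) \<one>"
    using n n0 by auto
  moreover have "n - n0 > m \<or> n0 - n > m" using n(3) by auto
  ultimately show ?thesis by blast
qed

text \<open>The dichotomy of Weil's lemma on cyclic subgroups, modulo \<open>D\<close>: recurrence
  of the powers already implies relative compactness. The point is a bound \<open>N\<close> such
  that every power is close, modulo \<open>D\<close>, to one of \<open>d [^] 1\<close>, ...,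
  \<open>d [^] N\<close>; a compact neighborhood \<open>P\<close> of the unit then completes
  \<open>C'\<close>.\<close>

lemma int_pow_relatively_compact:
  assumes lc: "locally_compact_space T"
    and D: "subgroup D G" and d: "d \<in> carrier G" and C: "compactin T C"
    and inf: "infinite {n::int. d [^] n \<in> C <#> D}"
  obtains C' where "compactin T C'" "range (\<lambda>n::int. d [^] n) \<subseteq> C' <#> D"
proof -
  note rec = int_pow_recurrence[OF D d C inf]
  obtain U P where UP: "openin T U" "compactin T P" "\<one> \<in> U" "U \<subseteq> P"
    by (rule compact_unit_neighborhood[OF lc])
  obtain V where V: "openin T V" "\<one> \<in> V" "V \<subseteq> U" "\<And>x. x \<in> V \<Longrightarrow> inv x \<in> V"
    using small_unit_neighborhood[OF UP(1,3)] by metis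
  obtain W where W: "openin T W" "\<one> \<in> W" "W \<subseteq> V" "\<And>x. x \<in> W \<Longrightarrow> inv x \<in> W"
    "\<And>x y. \<lbrakk>x \<in> W; y \<in> W\<rbrakk> \<Longrightarrow> x \<otimes> y \<in> V"
    using small_unit_neighborhood[OF V(1,2)] by metis
  have Wc: "W \<subseteq> carrier G" and Vc: "V \<subseteq> carrier G" using W V openin_subset_carrier by auto
  have Dc: "D \<subseteq> carrier G" using D by (rule subgroup.subset)
  define X where "X = range (\<lambda>n::int. d [^] n) <#> D"
  have Xc: "X \<subseteq> carrier G" using d Dc by (auto simp: X_def set_mult_def)
  define L where "L = P \<inter> T closure_of X"
  have L: "compactin T L" unfolding L_def by (rule compact_Int_closedin[OF UP(2)]) simp
  \<comment> \<open>A point of the closure is close to some \<open>d [^] m\<close> with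
    \<open>m\<close> of arbitrary sign. Multiplying by a recurrent power with exponent above
    \<open>\<bar>m\<bar>\<close> makes the exponent positive at the price of passing from
    \<open>W\<close> to \<open>V\<close>.\<close>
  have cov: "\<exists>n\<ge>1. near G V D p (d [^] (n::int))" if "p \<in> L" for p
  proof -
    have p: "p \<in> carrier G" using that L compactin_subset_carrier by blast
    have "openin T ({p} <#> W)" using p W by (intro openin_set_mult_right) auto
    moreover have "p \<in> {p} <#> W" using W(2) p set_multI[of p "{p}" \<one> W G] by simp
    moreover have "p \<in> T closure_of X" using \<open>p \<in> L\<close> by (simp add: L_def)
    ultimately obtain x where x: "x \<in> X" "x \<in> {p} <#> W"
      unfolding in_closure_of by blast
    then obtain m \<delta> w where m: "\<delta> \<in> D" "x = d [^] (m::int) \<otimes> \<delta>" "w \<in> W" "x = p \<otimes> w"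
      unfolding X_def by (blast elim: set_multE)
    have c: "\<delta> \<in> carrier G" "w \<in> carrier G" using m Dc Wc by auto
    have "d [^] m = p \<otimes> w \<otimes> inv \<delta>" using m c d p by (metis int_pow_closed inv_solve_right m_closed)
    then have "near G W D (d [^] m) p" unfolding near_def using m D subgroup.m_inv_closed by metis
    moreover obtain n where n: "n > \<bar>m\<bar>" "near G W D (d [^] n) \<one>" using rec[OF W(1,2)] by blast
    then have "near G W D (d [^] (n + m)) (d [^] m)"
      using near_int_pow_shift[of W D d n 0 m] Wc D d by simp
    ultimately have "near G V D (d [^] (n + m)) p"
      using near_trans[OF _ _ Wc W(5) D p] by blast
    then have "near G V D p (d [^] (n + m))" using near_sym[OF _ Vc V(4) D p] by blast
    moreover have "n + m \<ge> 1" using n(1) by auto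
    ultimately show ?thesis by blast
  qed
  \<comment> \<open>This turns closeness to a fixed \<open>a\<close> into membership in an open set,
    so that compactness of \<open>L\<close> bounds the positive exponents by
    \<open>N\<close>.\<close>
  have VD: "near G V D p a \<longleftrightarrow> p \<in> {a} <#> (D <#> V)" if "a \<in> carrier G" for p a
  proof -
    have "a \<otimes> v \<otimes> \<delta> = a \<otimes> (\<delta> \<otimes> v)" if "v \<in> V" "\<delta> \<in> D" for v \<delta>
      using that Vc Dc \<open>a \<in> carrier G\<close> by (simp add: m_ac subset_iff)
    then show ?thesis unfolding near_def set_mult_def by auto
  qed
  have "openin T ({d [^] n} <#> (D <#> V))" for n :: int
    using V Dc d by (intro openin_set_mult_right) auto
  then have o: "\<forall>A\<in>(\<lambda>n. {d [^] (n::int)} <#> (D <#> V)) ` {1..}. openin T A" by blast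
  have "L \<subseteq> \<Union>((\<lambda>n. {d [^] (n::int)} <#> (D <#> V)) ` {1..})"
    using cov VD d by fastforce
  with o L obtain \<F> where \<F>: "finite \<F>" "\<F> \<subseteq> (\<lambda>n. {d [^] (n::int)} <#> (D <#> V)) ` {1..}" "L \<subseteq> \<Union>\<F>"
    unfolding compactin_def by meson
  then obtain I where I: "finite I" "I \<subseteq> {1..}" "\<F> = (\<lambda>n. {d [^] (n::int)} <#> (D <#> V)) ` I"
    by (meson finite_subset_image)
  obtain N where N: "\<And>n. n \<in> I \<Longrightarrow> n \<le> (N::int)" using I(1) by (meson Max_ge)
  have covN: "\<exists>j\<in>{1..N}. near G V D p (d [^] j)" if p: "p \<in> L" for p
  proof -
    obtain j where "j \<in> I" "p \<in> {d [^] j} <#> (D <#> V)" using p \<F>(3) I(3) by blast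
    then show ?thesis using VD d N I(2) by (intro bexI[of _ j]) auto
  qed
  have main: "\<exists>n\<in>{1..N}. near G V D (d [^] m) (d [^] n)" for m :: int
  proof -
    \<comment> \<open>Recurrence provides a positive exponent close to \<open>m\<close> in this
      sense; the least one will turn out to be at most \<open>N\<close>.\<close>
    define J where "J n \<longleftrightarrow> n \<ge> 1 \<and> near G V D (d [^] int n) (d [^] m)" for n
    obtain k where k: "k > \<bar>m\<bar>" "near G V D (d [^] k) \<one>" using rec[OF V(1,2)] by blast
    have "near G V D (d [^] (k + m)) (d [^] m)"
      using near_int_pow_shift[of V D d k 0 m] Vc D d k(2) by simp
    moreover have "k + m \<ge> 1" using k(1) by linarith
    ultimately have "J (nat (k + m))" by (simp add: J_def)
    then have least: "J (LEAST n. J n)" by (rule LeastI)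
    define n where "n = (LEAST n. J n)"
    have n: "n \<ge> 1" "near G V D (d [^] int n) (d [^] m)" using least by (auto simp: J_def n_def)
    then have "near G V D (d [^] (int n - m)) \<one>"
      using near_int_pow_shift[of V D d "int n" m "- m"] Vc D d by simp
    then obtain v \<delta> where v: "v \<in> V" "\<delta> \<in> D" "d [^] (int n - m) = \<one> \<otimes> v \<otimes> \<delta>"
      unfolding near_def by blast
    have c: "v \<in> carrier G" "\<delta> \<in> carrier G" using v Vc Dc by auto
    have veq: "v = d [^] (int n - m) \<otimes> inv \<delta>" using v c d by (metis inv_solve_right int_pow_closed l_one)
    \<comment> \<open>The displacement \<open>v\<close> between the two powers, taken modulo
      \<open>D\<close>, belongs to \<open>X\<close> and to \<open>P\<close>, hence to
      \<open>L\<close>; so it is itself close to some \<open>d [^] j\<close> with \<open>j\<close>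
      in \<open>{1..N}\<close>.\<close>
    have "v \<in> X" unfolding veq X_def using subgroup.m_inv_closed[OF D v(2)] by (intro set_multI) auto
    then have "v \<in> T closure_of X" using closure_of_subset[of X T] Xc unfolding topspace_eq_carrier by blast
    then have "v \<in> L" using v V UP by (auto simp: L_def)
    then obtain j where j: "j \<in> {1..N}" "near G V D v (d [^] j)" using covN by blast
    obtain w \<delta>' where w: "w \<in> V" "\<delta>' \<in> D" "v = d [^] j \<otimes> w \<otimes> \<delta>'" using j(2) by (auto simp: near_def)
    have c': "w \<in> carrier G" "\<delta>' \<in> carrier G" using w Vc Dc by auto
    have "d [^] (int n - m) = d [^] j \<otimes> w \<otimes> (\<delta>' \<otimes> \<delta>)"
      using v(3) c c' d unfolding w(3) by (simp add: m_assoc)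
    then have "near G V D (d [^] (int n - m)) (d [^] j)"
      unfolding near_def using w v D by (metis subgroup.m_closed)
    then have near: "near G V D (d [^] (int n - j)) (d [^] m)"
      using near_int_pow_shift[of V D d "int n - m" j "m - j"] Vc D d by simp
    \<comment> \<open>Otherwise \<open>n - j\<close> would be a smaller positive exponent whose
      power is close to \<open>d [^] m\<close>.\<close>
    have "int n \<le> j"
    proof (rule ccontr)
      assume "\<not> int n \<le> j"
      then have "J (nat (int n - j))" using near by (simp add: J_def)
      then have "n \<le> nat (int n - j)" unfolding n_def by (rule Least_le)
      then show False using j \<open>\<not> int n \<le> j\<close> by auto
    qed
    moreover have "near G V D (d [^] m) (d [^] int n)" using near_sym[OF n(2) Vc V(4) D] d by simp
    ultimately show ?thesis using n(1) j(1) by (intro bexI[of _ "int n"]) auto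
  qed
  show ?thesis
  proof
    show "compactin T ((\<lambda>n::int. d [^] n) ` {1..N} <#> P)"
      using d by (intro compactin_set_mult UP finite_imp_compactin) (auto simp: topspace_eq_carrier)
    show "range (\<lambda>n::int. d [^] n) \<subseteq> (\<lambda>n::int. d [^] n) ` {1..N} <#> P <#> D"
    proof clarify
      fix m :: int
      obtain n v \<delta> where "n \<in> {1..N}" "v \<in> V" "\<delta> \<in> D" "d [^] m = d [^] n \<otimes> v \<otimes> \<delta>"
        using main[of m] unfolding near_def by blast
      then show "d [^] m \<in> (\<lambda>n::int. d [^] n) ` {1..N} <#> P <#> D"
        using V(3) UP(4) by (auto intro!: set_multI)
    qed
  qed
qed

end

context topological_comm_group
begin

text \<open>Induction on the generators \<open>F\<close>, enlarging \<open>\<Gamma>\<close> by the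
  cyclic group \<open>Z\<close> of the new generator \<open>d\<close>. Each step enlarges exactly
  one of \<open>C\<close> and \<open>D\<close>.\<close>

lemma near_cocompact_subgroup:
  assumes lc: "locally_compact_space T" and "finite F" "F \<subseteq> carrier G"
  shows "\<exists>\<Gamma> D C. subgroup \<Gamma> G \<and> F \<subseteq> \<Gamma> \<and> subgroup D G \<and> D \<subseteq> \<Gamma> \<and>
    (\<forall>x\<in>D. \<forall>n::int. n \<noteq> 0 \<longrightarrow> x [^] n = \<one> \<longrightarrow> x = \<one>) \<and>
    (\<forall>L. compactin T L \<longrightarrow> finite (L \<inter> D)) \<and> compactin T C \<and> \<Gamma> \<subseteq> C <#> D"
  using assms(2,3)
proof (induction F)
  case empty
  have "subgroup {\<one>} G" by (rule triv_subgroup)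
  moreover have "compactin T {\<one>}" by (simp add: topspace_eq_carrier)
  moreover have "{\<one>} \<subseteq> {\<one>} <#> {\<one>}" by (simp add: set_mult_def)
  ultimately show ?case by (intro exI[of _ "{\<one>}"]) auto
next
  case (insert d F)
  have "F \<subseteq> carrier G" using insert.prems by simp
  from insert.IH[OF this] obtain \<Gamma> D C where IH: "subgroup \<Gamma> G" "F \<subseteq> \<Gamma>" "subgroup D G" "D \<subseteq> \<Gamma>"
    "\<And>x n::int. \<lbrakk>x \<in> D; n \<noteq> 0; x [^] n = \<one>\<rbrakk> \<Longrightarrow> x = \<one>"
    "\<And>L. compactin T L \<Longrightarrow> finite (L \<inter> D)" "compactin T C" "\<Gamma> \<subseteq> C <#> D"
    by (elim exE conjE) metis
  have d: "d \<in> carrier G" using insert by auto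
  define Z where "Z = range (\<lambda>n::int. d [^] n)"
  have Z: "subgroup Z G"
  proof (rule subgroupI)
    show "Z \<subseteq> carrier G" "Z \<noteq> {}" using d by (auto simp: Z_def)
    show "inv a \<in> Z" if "a \<in> Z" for a using that d unfolding Z_def by (auto simp flip: int_pow_neg)
    show "a \<otimes> b \<in> Z" if "a \<in> Z" "b \<in> Z" for a b using that d unfolding Z_def by (auto simp flip: int_pow_mult)
  qed
  have Zc: "Z \<subseteq> carrier G" and Dc: "D \<subseteq> carrier G" and \<Gamma>c: "\<Gamma> \<subseteq> carrier G" and Cc: "C \<subseteq> carrier G"
    using subgroup.subset[OF Z] subgroup.subset[OF IH(3)] subgroup.subset[OF IH(1)]
      compactin_subset_carrier[OF IH(7)] by auto
  have "\<one> \<in> Z" "d \<in> Z" using d rangeI[of "\<lambda>n::int. d [^] n" 0] rangeI[of "\<lambda>n::int. d [^] n" 1] by (auto simp: Z_def)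
  have one: "\<one> \<in> \<Gamma>" "\<one> \<in> D" using IH(1,3) by (auto intro: subgroup.one_closed)
  have \<Gamma>Z: "subgroup (\<Gamma> <#> Z) G" by (rule mult_subgroups[OF IH(1) Z])
  have sub1: "\<Gamma> \<subseteq> \<Gamma> <#> Z"
  proof
    fix x assume "x \<in> \<Gamma>"
    then show "x \<in> \<Gamma> <#> Z" using set_multI[of x \<Gamma> \<one> Z G] \<open>\<one> \<in> Z\<close> \<Gamma>c by auto
  qed
  have "d \<in> \<Gamma> <#> Z" using set_multI[of \<one> \<Gamma> d Z G] one \<open>d \<in> Z\<close> d by auto
  then have F: "insert d F \<subseteq> \<Gamma> <#> Z" using sub1 IH(2) by auto
  show ?case
  \<comment> \<open>If the powers of \<open>d\<close> return infinitely often to a compact set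
    modulo \<open>D\<close>, all of them lie in \<open>C' <#> D\<close> for one compact
    \<open>C'\<close>, so \<open>C\<close> grows to \<open>C <#> C'\<close>. Otherwise
    \<open>D\<close> grows to \<open>D <#> Z\<close>.\<close>
  proof (cases "\<exists>C'. compactin T C' \<and> infinite {n::int. d [^] n \<in> C' <#> D}")
    case True
    then obtain C' where "compactin T C'" "Z \<subseteq> C' <#> D"
      using int_pow_relatively_compact[OF lc IH(3) d] unfolding Z_def by metis
    then have "\<Gamma> <#> Z \<subseteq> (C <#> D) <#> (C' <#> D)" using IH(8) by (intro mono_set_mult)
    also have "\<dots> \<subseteq> (C <#> C') <#> D"
    proof
      fix x assume "x \<in> (C <#> D) <#> (C' <#> D)"
      then obtain c \<delta> c' \<delta>' where x: "c \<in> C" "\<delta> \<in> D" "c' \<in> C'" "\<delta>' \<in> D" "x = (c \<otimes> \<delta>) \<otimes> (c' \<otimes> \<delta>')"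
        by (auto elim!: set_multE)
      moreover have "c' \<in> carrier G" using x \<open>compactin T C'\<close> compactin_subset_carrier by blast
      ultimately have "x = (c \<otimes> c') \<otimes> (\<delta> \<otimes> \<delta>')" using Cc Dc by (simp add: m_ac subset_iff)
      then show "x \<in> (C <#> C') <#> D" using x IH(3) by (auto intro!: set_multI subgroup.m_closed)
    qed
    finally have cov: "\<Gamma> <#> Z \<subseteq> (C <#> C') <#> D" .
    have "compactin T (C <#> C')" using IH(7) \<open>compactin T C'\<close> by (rule compactin_set_mult)
    moreover have "D \<subseteq> \<Gamma> <#> Z" using IH(4) sub1 by (rule subset_trans)
    ultimately show ?thesis using cov
      by (intro exI[of _ "\<Gamma> <#> Z"] exI[of _ D] exI[of _ "C <#> C'"] conjI ballI allI impI
          \<Gamma>Z F IH(3,6)) (auto intro: IH(5))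
  next
    case False
    then have fin: "\<And>C'. compactin T C' \<Longrightarrow> finite {n::int. d [^] n \<in> C' <#> D}" by blast
    \<comment> \<open>For \<open>x = \<delta> \<otimes> d [^] k\<close> of finite order
      \<open>d [^] (k * n)\<close> lies in \<open>D\<close>, and so do all its powers. Since only
      finitely many exponents lead into \<open>{\<one>} <#> D\<close>, this forces
      \<open>k = 0\<close>, and torsion-freeness of \<open>D\<close> finishes.\<close>
    have tf: "x = \<one>" if x: "x \<in> D <#> Z" "n \<noteq> 0" "x [^] n = \<one>" for x and n :: int
    proof -
      obtain \<delta> k where \<delta>: "\<delta> \<in> D" "x = \<delta> \<otimes> d [^] (k::int)" using x(1) by (auto elim!: set_multE simp: Z_def)
      have \<delta>c: "\<delta> \<in> carrier G" using \<delta> Dc by auto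
      have "\<delta> [^] n \<otimes> d [^] (k * n) = \<one>"
        using x(3) \<delta>c d unfolding \<delta>(2) by (simp add: int_pow_distrib int_pow_pow)
      then have "d [^] (k * n) = inv (\<delta> [^] n)" using \<delta>c d by (metis inv_equality inv_inv int_pow_closed inv_closed)
      then have dD: "d [^] (k * n) = \<delta> [^] (- n)" using \<delta>c by (simp add: int_pow_neg)
      have "d [^] (k * n * j) \<in> {\<one>} <#> D" for j :: int
      proof -
        have "d [^] (k * n * j) = \<delta> [^] (- n * j)"
          using dD \<delta>c d by (metis int_pow_pow)
        also have "\<dots> \<in> D" using \<delta>(1) IH(3) subgroup_int_pow_closed by blast
        finally have "d [^] (k * n * j) \<in> D" .
        then show ?thesis using set_multI[of \<one> "{\<one>}" "d [^] (k * n * j)" D G] d by simp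
      qed
      then have "range (\<lambda>j. k * n * j) \<subseteq> {n::int. d [^] n \<in> {\<one>} <#> D}" by auto
      then have "finite (range (\<lambda>j. k * n * j))"
        using fin[of "{\<one>}"] finite_subset by (auto simp: topspace_eq_carrier)
      moreover have "inj (\<lambda>j. k * n * j)" if "k \<noteq> 0" using that x(2) by (auto simp: inj_on_def)
      ultimately have "k = 0" using finite_imageD infinite_UNIV_int by metis
      then have "x = \<delta>" using \<delta> \<delta>c by simp
      then show ?thesis using IH(5)[OF \<delta>(1) x(2)] x(3) by simp
    qed
    have lf: "finite (L \<inter> (D <#> Z))" if L: "compactin T L" for L
    proof -
      have Lc: "L \<subseteq> carrier G" using L by (rule compactin_subset_carrier)
      let ?I = "{n::int. d [^] n \<in> L <#> D}"
      \<comment> \<open>If \<open>x = \<delta> \<otimes> d [^] n\<close> lies in \<open>L\<close>,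
        then \<open>d [^] n\<close> lies in \<open>L <#> D\<close>, which leaves finitely many
        \<open>n\<close>; for each of them \<open>\<delta>\<close> lies in a compact translate of
        \<open>L\<close>, which leaves finitely many \<open>\<delta>\<close>.\<close>
      have "L \<inter> (D <#> Z) \<subseteq> (\<Union>n\<in>?I. (\<lambda>\<delta>. \<delta> \<otimes> d [^] n) ` ((L <#> {inv (d [^] n)}) \<inter> D))"
      proof
        fix x assume x: "x \<in> L \<inter> (D <#> Z)"
        then obtain \<delta> n where \<delta>: "\<delta> \<in> D" "x = \<delta> \<otimes> d [^] (n::int)" by (auto elim!: set_multE simp: Z_def)
        have c: "\<delta> \<in> carrier G" "x \<in> carrier G" using \<delta> Dc x Lc by auto
        have "d [^] n = x \<otimes> inv \<delta>" using \<delta>(2) c d by (metis inv_solve_right int_pow_closed m_comm)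
        then have "n \<in> ?I" using x \<delta>(1) IH(3) set_multI[of x L "inv \<delta>" D G] by (auto intro: subgroup.m_inv_closed)
        moreover have "\<delta> = x \<otimes> inv (d [^] n)" using \<delta>(2) c d by (metis inv_solve_right int_pow_closed)
        then have "\<delta> \<in> L <#> {inv (d [^] n)}" using x set_multI[of x L "inv (d [^] n)" _ G] by auto
        ultimately show "x \<in> (\<Union>n\<in>?I. (\<lambda>\<delta>. \<delta> \<otimes> d [^] n) ` ((L <#> {inv (d [^] n)}) \<inter> D))"
          using \<delta> by blast
      qed
      moreover have "finite ((L <#> {inv (d [^] n)}) \<inter> D)" for n :: int
        using d by (intro IH(6) compactin_set_mult L) (auto simp: topspace_eq_carrier)
      ultimately show ?thesis using fin[OF L] by (auto intro: finite_subset)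
    qed
    have "\<Gamma> <#> Z \<subseteq> (C <#> D) <#> Z" using IH(8) by (intro mono_set_mult) auto
    also have "\<dots> = C <#> (D <#> Z)" using Cc Dc Zc by (rule set_mult_assoc)
    finally have cov: "\<Gamma> <#> Z \<subseteq> C <#> (D <#> Z)" .
    have "D <#> Z \<subseteq> \<Gamma> <#> Z" using IH(4) by (intro mono_set_mult) auto
    moreover have "subgroup (D <#> Z) G" by (rule mult_subgroups[OF IH(3) Z])
    ultimately show ?thesis using cov
      by (intro exI[of _ "\<Gamma> <#> Z"] exI[of _ "D <#> Z"] exI[of _ C] conjI ballI allI impI
          \<Gamma>Z F lf IH(7)) (auto intro: tf)
  qed
qed

text \<open>Let \<open>Q\<close> be a compact symmetric neighborhood of the unit. Then
  \<open>Q <#> Q\<close> is covered by finitely many translates \<open>F <#> U\<close>, so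
  \<open>Q <#> \<Gamma>\<close> is closed under products once \<open>\<Gamma>\<close> contains
  \<open>F\<close>, and it is open because it contains \<open>U\<close>. This reduces the task to
  finitely many generators.\<close>

lemma open_subgroup_cocompact_discrete:
  assumes lc: "locally_compact_space T"
  obtains G0 D C where "subgroup G0 G" "openin T G0" "subgroup D G" "D \<subseteq> G0"
    "\<And>x n::int. \<lbrakk>x \<in> D; n \<noteq> 0; x [^] n = \<one>\<rbrakk> \<Longrightarrow> x = \<one>"
    "\<And>L. compactin T L \<Longrightarrow> finite (L \<inter> D)" "compactin T C" "G0 \<subseteq> C <#> D"
proof -
  obtain U P where UP: "openin T U" "compactin T P" "\<one> \<in> U" "U \<subseteq> P"
    by (rule compact_unit_neighborhood[OF lc])
  define Q where "Q = P \<union> (\<lambda>x. inv x) ` P"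
  have Q: "compactin T Q" unfolding Q_def by (intro compactin_Un UP compactin_inv)
  have Pc: "P \<subseteq> carrier G" using UP compactin_subset_carrier by blast
  have Qc: "Q \<subseteq> carrier G" using Q compactin_subset_carrier by blast
  have Qinv: "inv x \<in> Q" if "x \<in> Q" for x using that Pc by (auto simp: Q_def)
  have UQ: "U \<subseteq> Q" using UP by (auto simp: Q_def)
  obtain F where F: "finite F" "F \<subseteq> Q <#> Q" "Q <#> Q \<subseteq> F <#> U"
    by (rule compact_finite_translates[OF compactin_set_mult[OF Q Q] UP(1,3)])
  have Fc: "F \<subseteq> carrier G" using F(2) Qc by (auto simp: set_mult_def)
  obtain \<Gamma> D C where \<Gamma>: "subgroup \<Gamma> G" "F \<subseteq> \<Gamma>" "subgroup D G" "D \<subseteq> \<Gamma>"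
    "\<And>x n::int. \<lbrakk>x \<in> D; n \<noteq> 0; x [^] n = \<one>\<rbrakk> \<Longrightarrow> x = \<one>"
    "\<And>L. compactin T L \<Longrightarrow> finite (L \<inter> D)" "compactin T C" "\<Gamma> \<subseteq> C <#> D"
    using near_cocompact_subgroup[OF lc F(1) Fc] by (elim exE conjE) metis
  have \<Gamma>c: "\<Gamma> \<subseteq> carrier G" using subgroup.subset[OF \<Gamma>(1)] .
  define G0 where "G0 = Q <#> \<Gamma>"
  have G0c: "G0 \<subseteq> carrier G" using Qc \<Gamma>c by (auto simp: G0_def set_mult_def)
  have UG0: "x \<in> G0" if "x \<in> U" for x
  proof -
    have "x \<in> Q" "x \<in> carrier G" using that UQ Qc by auto
    then show ?thesis using set_multI[of x Q \<one> \<Gamma> G] subgroup.one_closed[OF \<Gamma>(1)] by (simp add: G0_def)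
  qed
  have sub: "subgroup G0 G"
  proof (rule subgroupI)
    show "G0 \<subseteq> carrier G" by (rule G0c)
    show "G0 \<noteq> {}" using UG0 UP(3) by blast
    show "inv a \<in> G0" if a: "a \<in> G0" for a
    proof -
      obtain q \<gamma> where "q \<in> Q" "\<gamma> \<in> \<Gamma>" "a = q \<otimes> \<gamma>" by (rule set_multE[OF a[unfolded G0_def]])
      moreover from this have "inv a = inv q \<otimes> inv \<gamma>" using Qc \<Gamma>c by (simp add: inv_mult subset_iff)
      ultimately show ?thesis unfolding G0_def using Qinv subgroup.m_inv_closed[OF \<Gamma>(1)] by (auto intro!: set_multI)
    qed
    show "a \<otimes> b \<in> G0" if ab: "a \<in> G0" "b \<in> G0" for a b
    proof -
      obtain q \<gamma> q' \<gamma>' where q: "q \<in> Q" "\<gamma> \<in> \<Gamma>" "a = q \<otimes> \<gamma>" "q' \<in> Q" "\<gamma>' \<in> \<Gamma>" "b = q' \<otimes> \<gamma>'"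
        using ab unfolding G0_def by (auto elim!: set_multE)
      then have qq: "q \<otimes> q' \<in> F <#> U" using F(3) by (auto intro: set_multI)
      obtain f u where f: "f \<in> F" "u \<in> U" "q \<otimes> q' = f \<otimes> u" by (rule set_multE[OF qq])
      have c: "q \<in> carrier G" "q' \<in> carrier G" "\<gamma> \<in> carrier G" "\<gamma>' \<in> carrier G" "f \<in> carrier G" "u \<in> carrier G"
        using q f Qc \<Gamma>c Fc UQ by auto
      have "a \<otimes> b = (q \<otimes> q') \<otimes> (\<gamma> \<otimes> \<gamma>')" using q c by (simp add: m_ac)
      also have "\<dots> = u \<otimes> (f \<otimes> (\<gamma> \<otimes> \<gamma>'))" unfolding f(3) using c by (simp add: m_ac)
      finally show ?thesis unfolding G0_def using f q UQ \<Gamma>(1,2)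
        by (auto intro!: set_multI subgroup.m_closed)
    qed
  qed
  show ?thesis
  proof
    show "openin T G0"
    proof -
      have "G0 <#> U \<subseteq> G0" using UG0 sub by (auto elim!: set_multE intro: subgroup.m_closed)
      moreover have "G0 \<subseteq> G0 <#> U"
      proof
        fix x assume "x \<in> G0"
        then show "x \<in> G0 <#> U" using set_multI[of x G0 \<one> U G] UP(3) G0c by auto
      qed
      ultimately show ?thesis using openin_set_mult_right[OF UP(1) G0c] by simp
    qed
    show "D \<subseteq> G0"
    proof
      fix x assume "x \<in> D"
      then have "x \<in> \<Gamma>" "x \<in> carrier G" "\<one> \<in> Q" using \<Gamma>(4) \<Gamma>c UP(3) UQ by auto
      then show "x \<in> G0" using set_multI[of \<one> Q x \<Gamma> G] by (simp add: G0_def)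
    qed
    show "compactin T (Q <#> C)" by (rule compactin_set_mult[OF Q \<Gamma>(7)])
    have "G0 \<subseteq> Q <#> (C <#> D)" unfolding G0_def using \<Gamma>(8) by (intro mono_set_mult) auto
    also have "\<dots> = (Q <#> C) <#> D"
      by (rule set_mult_assoc[symmetric]) (use Qc compactin_subset_carrier[OF \<Gamma>(7)] subgroup.subset[OF \<Gamma>(3)] in auto)
    finally show "G0 \<subseteq> (Q <#> C) <#> D" .
  qed (use sub \<Gamma> in auto)
qed

text \<open>All powers of a common element lie in the finite set \<open>K \<inter> D\<close>, so two
  of them coincide and the element has finite order.\<close>

lemma compact_Int_torsion_free_discrete:
  assumes K: "subgroup K G" "compactin T K" and D: "subgroup D G"
    and tf: "\<And>x n::int. \<lbrakk>x \<in> D; n \<noteq> 0; x [^] n = \<one>\<rbrakk> \<Longrightarrow> x = \<one>"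
    and lf: "\<And>L. compactin T L \<Longrightarrow> finite (L \<inter> D)"
  shows "K \<inter> D = {\<one>}"
proof (intro equalityI subsetI)
  fix x assume x: "x \<in> K \<inter> D"
  then have xc: "x \<in> carrier G" using K subgroup.subset by blast
  have "range (\<lambda>n::int. x [^] n) \<subseteq> K \<inter> D"
    using x K(1) D subgroup_int_pow_closed by blast
  then have "finite (range (\<lambda>n::int. x [^] n))" using lf[OF K(2)] finite_subset by blast
  then have "\<not> inj (\<lambda>n::int. x [^] n)" using finite_imageD infinite_UNIV_int by blast
  then obtain m n :: int where "m \<noteq> n" "x [^] m = x [^] n" by (auto simp: inj_on_def)
  then have "x [^] (m - n) = \<one>" "m - n \<noteq> 0" using xc by (auto simp: int_pow_diff)
  then show "x \<in> {\<one>}" using tf x by blast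
qed (use K(1) D subgroup.one_closed in auto)

text \<open>This is continuity at the unit of the inverse of the map from \<open>G\<close> to the
  product of its quotients by \<open>K\<close> and \<open>D\<close>. If
  \<open>w \<otimes> k = w' \<otimes> \<delta>\<close>, only finitely many \<open>\<delta>\<close>
  are possible, and a small \<open>W\<close> rules out all but the trivial one; then the point is
  \<open>w'\<close> itself.\<close>

lemma compact_discrete_separation:
  assumes lc: "locally_compact_space T"
    and K: "subgroup K G" "compactin T K" "closedin T K" and D: "subgroup D G"
    and KD: "K \<inter> D = {\<one>}" and lf: "\<And>L. compactin T L \<Longrightarrow> finite (L \<inter> D)"
    and V: "openin T V" "\<one> \<in> V"
  obtains W where "openin T W" "\<one> \<in> W" "(W <#> K) \<inter> (W <#> D) \<subseteq> V"
proof -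
  obtain U P where UP: "openin T U" "compactin T P" "\<one> \<in> U" "U \<subseteq> P"
    by (rule compact_unit_neighborhood[OF lc])
  obtain W0 where W0: "openin T W0" "\<one> \<in> W0" "W0 \<subseteq> U" "\<And>x. x \<in> W0 \<Longrightarrow> inv x \<in> W0"
    using small_unit_neighborhood[OF UP(1,3)] by metis
  have W0c: "W0 \<subseteq> carrier G" and Dc: "D \<subseteq> carrier G" and Kc: "K \<subseteq> carrier G"
    using openin_subset_carrier[OF W0(1)] subgroup.subset[OF D] subgroup.subset[OF K(1)] by auto
  \<comment> \<open>From \<open>w \<otimes> k = w' \<otimes> \<delta>\<close> one gets
    \<open>\<delta> = inv w' \<otimes> w \<otimes> k\<close>, which lies in this compact set;
    \<open>E\<close> collects the nontrivial candidates.\<close>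
  define E where "E = ((P <#> P <#> K) \<inter> D) - {\<one>}"
  have "finite E" unfolding E_def by (intro finite_Diff lf compactin_set_mult UP K)
  have Ec: "E \<subseteq> carrier G" using Dc by (auto simp: E_def)
  \<comment> \<open>A candidate \<open>\<delta>\<close> lies outside the closed \<open>K\<close>,
    and stays outside when multiplied by two elements of a small symmetric \<open>W\<close>.\<close>
  have "\<exists>W. openin T W \<and> \<one> \<in> W \<and> (\<forall>x\<in>W. inv x \<in> W) \<and> (\<forall>x\<in>W. \<forall>y\<in>W. x \<otimes> y \<otimes> \<delta> \<notin> K)" if \<delta>: "\<delta> \<in> E" for \<delta>
  proof -
    define Z where "Z = {x \<in> carrier G. x \<otimes> \<delta> \<in> carrier G - K}"
    have "openin T (carrier G - K)" using K(3) by (simp add: closedin_def topspace_eq_carrier)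
    then have Z: "openin T Z" using \<delta> Ec unfolding Z_def by (intro openin_preimage_r_mult) auto
    have "\<delta> \<notin> K" using \<delta> KD by (auto simp: E_def)
    then have Z1: "\<one> \<in> Z" using \<delta> Ec by (auto simp: Z_def)
    obtain W where "openin T W" "\<one> \<in> W" "\<And>x. x \<in> W \<Longrightarrow> inv x \<in> W"
      "\<And>x y. \<lbrakk>x \<in> W; y \<in> W\<rbrakk> \<Longrightarrow> x \<otimes> y \<in> Z"
      using small_unit_neighborhood[OF Z Z1] by metis
    moreover have "z \<otimes> \<delta> \<notin> K" if "z \<in> Z" for z using that by (auto simp: Z_def)
    ultimately show ?thesis by (intro exI[of _ W]) metis
  qed
  then obtain W where W: "\<And>\<delta>. \<delta> \<in> E \<Longrightarrow> openin T (W \<delta>) \<and> \<one> \<in> W \<delta> \<and> (\<forall>x\<in>W \<delta>. inv x \<in> W \<delta>) \<and>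
    (\<forall>x\<in>W \<delta>. \<forall>y\<in>W \<delta>. x \<otimes> y \<otimes> \<delta> \<notin> K)"
    by metis
  define W' where "W' = V \<inter> W0 \<inter> ((\<Inter>\<delta>\<in>E. W \<delta>) \<inter> topspace T)"
  show ?thesis
  proof
    show "openin T W'" unfolding W'_def
      using V(1) W0(1) W by (intro openin_Int openin_INT[OF \<open>finite E\<close>]) auto
    show "\<one> \<in> W'" unfolding W'_def using V W0 W by (auto simp: topspace_eq_carrier)
    show "(W' <#> K) \<inter> (W' <#> D) \<subseteq> V"
    proof
      fix x assume "x \<in> (W' <#> K) \<inter> (W' <#> D)"
      then obtain w k w' \<delta> where x: "w \<in> W'" "k \<in> K" "x = w \<otimes> k" "w' \<in> W'" "\<delta> \<in> D" "x = w' \<otimes> \<delta>"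
        by (auto elim!: set_multE)
      have c: "w \<in> carrier G" "k \<in> carrier G" "w' \<in> carrier G" "\<delta> \<in> carrier G"
        using x Kc Dc W0c by (auto simp: W'_def)
      have d: "\<delta> = inv w' \<otimes> w \<otimes> k" and k: "k = inv w \<otimes> w' \<otimes> \<delta>"
        using x(3,6) c by (simp_all add: m_assoc inv_solve_left)
      have "inv w' \<in> P" "w \<in> P" using x W0 UP by (auto simp: W'_def)
      then have "\<delta> \<in> P <#> P <#> K" unfolding d using x(2) by (intro set_multI)
      moreover have "\<delta> \<notin> E"
      proof
        assume E: "\<delta> \<in> E"
        then have "inv w \<in> W \<delta>" "w' \<in> W \<delta>" using x W by (auto simp: W'_def)
        then show False using W[OF E] k x(2) by metis
      qed
      ultimately have "\<delta> = \<one>" using x(5) by (auto simp: E_def)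
      then show "x \<in> V" using x(4,6) c by (auto simp: W'_def)
    qed
  qed
qed

end

section \<open>Restricted powers\<close>

text \<open>Any \<open>h\<close> is continuous on a discrete space. This is how the coset sequence
  of a restricted power is followed through the group operations.\<close>

lemma continuous_map_discrete_combine:
  assumes "continuous_map X (discrete_topology UNIV) f" "continuous_map X (discrete_topology UNIV) g"
  shows "continuous_map X (discrete_topology UNIV) (\<lambda>x. h (f x) (g x))"
proof -
  have "continuous_map X (discrete_topology UNIV) (\<lambda>x. (f x, g x))"
    using continuous_map_pairedI[OF assms] by (simp flip: prod_topology_discrete_topology)
  from continuous_map_compose[OF this, of "discrete_topology UNIV" "case_prod h"]
  show ?thesis by (simp add: o_def)
qed

definition restricted_power :: "('a, 'b) monoid_scheme \<Rightarrow> 'a set \<Rightarrow> (nat \<Rightarrow> 'a) monoid" where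
  "restricted_power A C =
    \<lparr>carrier = {x. (\<forall>i. x i \<in> carrier A) \<and> finite {i. x i \<notin> C}},
     mult = \<lambda>x y i. x i \<otimes>\<^bsub>A\<^esub> y i, one = \<lambda>i. \<one>\<^bsub>A\<^esub>\<rparr>"

text \<open>The discrete second factor makes \<open>C\<^sup>\<nat>\<close> an open subgroup.\<close>

definition restricted_power_topology ::
  "('a, 'b) monoid_scheme \<Rightarrow> 'a topology \<Rightarrow> 'a set \<Rightarrow> (nat \<Rightarrow> 'a) topology" where
  "restricted_power_topology A T C =
    pullback_topology (carrier (restricted_power A C)) (\<lambda>x. (x, \<lambda>i. C #>\<^bsub>A\<^esub> x i))
      (prod_topology (product_topology (\<lambda>i. T) UNIV) (discrete_topology UNIV))"

text \<open>The identity off the carrier, so that transvections are bijections of the whole type.\<close>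

definition transvection ::
  "('a, 'b) monoid_scheme \<Rightarrow> 'a set \<Rightarrow> nat \<Rightarrow> nat \<Rightarrow> bool \<Rightarrow> (nat \<Rightarrow> 'a) \<Rightarrow> nat \<Rightarrow> 'a" where
  "transvection A C i j b x =
    (if x \<in> carrier (restricted_power A C)
     then x(i := x i \<otimes>\<^bsub>A\<^esub> (if b then x j else inv\<^bsub>A\<^esub> x j)) else x)"

locale compact_open_subgroup = topological_comm_group A T for A (structure) and T +
  fixes C
  assumes subgroup_C: "subgroup C A" and openin_C: "openin T C" and compactin_C: "compactin T C"
begin

abbreviation "RP \<equiv> restricted_power A C"
abbreviation "TRP \<equiv> restricted_power_topology A T C"

lemma C_normal: "C \<lhd> A"
  using subgroup_C by (rule subgroup_imp_normal)

lemma C_subset: "C \<subseteq> carrier A"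
  by (rule subgroup.subset[OF subgroup_C])

lemma carrier_RP: "x \<in> carrier RP \<longleftrightarrow> (\<forall>i. x i \<in> carrier A) \<and> finite {i. x i \<notin> C}"
  by (simp add: restricted_power_def)

lemma mult_RP: "x \<otimes>\<^bsub>RP\<^esub> y = (\<lambda>i. x i \<otimes> y i)"
  by (simp add: restricted_power_def)

lemma one_RP: "\<one>\<^bsub>RP\<^esub> = (\<lambda>i. \<one>)"
  by (simp add: restricted_power_def)

lemma C_powers_in_RP: "(\<And>i. x i \<in> C) \<Longrightarrow> x \<in> carrier RP"
  using C_subset by (auto simp: carrier_RP)

lemma mult_mem_RP:
  assumes "x \<in> carrier RP" "y \<in> carrier RP"
  shows "(\<lambda>i. x i \<otimes> y i) \<in> carrier RP"
proof -
  have "{i. x i \<otimes> y i \<notin> C} \<subseteq> {i. x i \<notin> C} \<union> {i. y i \<notin> C}"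
    using subgroup.m_closed[OF subgroup_C] by auto
  then show ?thesis using assms by (auto simp: carrier_RP intro: finite_subset)
qed

lemma inv_mem_RP:
  assumes "x \<in> carrier RP"
  shows "(\<lambda>i. inv x i) \<in> carrier RP"
proof -
  have "{i. inv x i \<notin> C} \<subseteq> {i. x i \<notin> C}"
    using subgroup.m_inv_closed[OF subgroup_C] by auto
  then show ?thesis using assms by (auto simp: carrier_RP intro: finite_subset)
qed

lemma comm_group_RP: "comm_group RP"
proof (rule comm_groupI)
  show "\<one>\<^bsub>RP\<^esub> \<in> carrier RP"
    unfolding one_RP by (rule C_powers_in_RP) (rule subgroup.one_closed[OF subgroup_C])
  show "\<exists>y\<in>carrier RP. y \<otimes>\<^bsub>RP\<^esub> x = \<one>\<^bsub>RP\<^esub>" if "x \<in> carrier RP" for x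
    using that inv_mem_RP[OF that] by (intro bexI[of _ "\<lambda>i. inv x i"]) (auto simp: mult_RP one_RP carrier_RP)
  show "x \<otimes>\<^bsub>RP\<^esub> y \<in> carrier RP" if "x \<in> carrier RP" "y \<in> carrier RP" for x y
    unfolding mult_RP by (rule mult_mem_RP[OF that])
qed (auto simp: mult_RP one_RP m_ac carrier_RP)

lemma inv_RP:
  assumes "x \<in> carrier RP"
  shows "inv\<^bsub>RP\<^esub> x = (\<lambda>i. inv x i)"
proof -
  interpret R: comm_group RP by (rule comm_group_RP)
  show ?thesis
    by (rule R.inv_equality) (use assms inv_mem_RP in \<open>auto simp: mult_RP one_RP carrier_RP\<close>)
qed

lemma coset_mult: "\<lbrakk>a \<in> carrier A; b \<in> carrier A\<rbrakk> \<Longrightarrow> C #> (a \<otimes> b) = (C #> a) <#> (C #> b)"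
  using normal.rcos_sum[OF C_normal] by simp

lemma coset_inv: "a \<in> carrier A \<Longrightarrow> C #> inv a = set_inv (C #> a)"
  using normal.rcos_inv[OF C_normal] by simp

lemma coset_C: "c \<in> C \<Longrightarrow> C #> c = C"
  using subgroup_C C_subset coset_join2 by blast

lemma topspace_RP: "topspace TRP = carrier RP"
  by (auto simp: restricted_power_topology_def topspace_pullback_topology topspace_eq_carrier carrier_RP)

lemma continuous_map_coset_RP:
  "continuous_map TRP (discrete_topology UNIV) (\<lambda>x i. C #> x i)"
  using continuous_map_pullback[of "prod_topology (product_topology (\<lambda>i. T) UNIV) (discrete_topology UNIV)"
      "discrete_topology UNIV" snd "carrier RP" "\<lambda>x. (x, \<lambda>i. C #> x i)"]
  by (simp add: continuous_map_snd restricted_power_topology_def o_def)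

lemma continuous_map_proj_RP: "continuous_map TRP T (\<lambda>x. x k)"
proof -
  have "continuous_map (prod_topology (product_topology (\<lambda>i. T) UNIV) (discrete_topology UNIV)) T
      ((\<lambda>x. x k) \<circ> fst)"
    by (intro continuous_map_compose[OF continuous_map_fst] continuous_map_product_projection) auto
  from continuous_map_pullback[OF this, of "carrier RP" "\<lambda>x. (x, \<lambda>i. C #> x i)"]
  show ?thesis by (simp add: restricted_power_topology_def o_def)
qed

text \<open>The pullback is the initial topology for the coordinates and the coset sequence, so only
  these two have to be tested.\<close>

lemma continuous_map_into_RP:
  assumes "\<And>x. x \<in> topspace X \<Longrightarrow> f x \<in> carrier RP" "\<And>k. continuous_map X T (\<lambda>x. f x k)"
    "continuous_map X (discrete_topology UNIV) (\<lambda>x i. C #> f x i)"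
  shows "continuous_map X TRP f"
  unfolding restricted_power_topology_def
proof (rule continuous_map_pullback')
  show "continuous_map X (prod_topology (product_topology (\<lambda>i. T) UNIV) (discrete_topology UNIV))
      ((\<lambda>x. (x, \<lambda>i. C #> x i)) \<circ> f)"
    unfolding o_def
    by (intro continuous_map_pairedI assms(3)) (simp add: continuous_map_componentwise_UNIV assms(2))
  show "topspace X \<subseteq> f -` carrier RP" using assms(1) by auto
qed

lemma topological_comm_group_RP: "topological_comm_group RP TRP"
proof -
  interpret R: comm_group RP by (rule comm_group_RP)
  have fst: "continuous_map (prod_topology TRP TRP) Y (\<lambda>z. f (fst z))"
    and snd: "continuous_map (prod_topology TRP TRP) Y (\<lambda>z. f (snd z))"
    if "continuous_map TRP Y f" for Y :: "'x topology" and f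
    using continuous_map_compose[OF continuous_map_fst that] continuous_map_compose[OF continuous_map_snd that]
    by (simp_all add: o_def)
  \<comment> \<open>The coset sequence of a product is determined by the coset sequences of the
    factors, because \<open>C\<close> is normal.\<close>
  have "continuous_map (prod_topology TRP TRP) (discrete_topology UNIV)
      (\<lambda>z i. (C #> fst z i) <#> (C #> snd z i))"
    by (rule continuous_map_discrete_combine[where h = "\<lambda>a b i. a i <#> b i"])
       (rule fst snd, rule continuous_map_coset_RP)+
  then have d: "continuous_map (prod_topology TRP TRP) (discrete_topology UNIV)
      (\<lambda>z i. C #> (fst z i \<otimes> snd z i))"
    by (rule continuous_map_eq) (auto simp: topspace_RP carrier_RP coset_mult)
  have "continuous_map (prod_topology TRP TRP) TRP (\<lambda>z i. fst z i \<otimes> snd z i)"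
    by (rule continuous_map_into_RP)
       (auto intro!: mult_mem_RP d continuous_map_mult fst snd continuous_map_proj_RP simp: topspace_RP)
  moreover
  have "continuous_map TRP (discrete_topology UNIV) (\<lambda>x i. set_inv (C #> x i))"
    by (rule continuous_map_discrete_combine[where h = "\<lambda>a b i. set_inv (a i)",
        OF continuous_map_coset_RP continuous_map_coset_RP])
  then have d': "continuous_map TRP (discrete_topology UNIV) (\<lambda>x i. C #> inv x i)"
    by (rule continuous_map_eq) (auto simp: topspace_RP carrier_RP coset_inv)
  have "continuous_map TRP TRP (\<lambda>x i. inv x i)"
    by (rule continuous_map_into_RP)
       (auto intro!: inv_mem_RP d' continuous_map_m_inv continuous_map_proj_RP simp: topspace_RP)
  then have "continuous_map TRP TRP (\<lambda>x. inv\<^bsub>RP\<^esub> x)"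
    by (rule continuous_map_eq) (simp add: topspace_RP inv_RP)
  ultimately show ?thesis
    by unfold_locales (simp_all add: topspace_RP mult_RP case_prod_unfold)
qed

text \<open>The power of \<open>C\<close> is the fibre of the coset sequence over the constant
  sequence \<open>C\<close>, hence open. It is compact by Tychonoff: on it the coset sequence is
  constant, so the identity from the product topology is continuous.\<close>

lemma locally_compact_RP: "locally_compact_space TRP"
proof -
  interpret R: topological_comm_group RP TRP by (rule topological_comm_group_RP)
  let ?P = "{x. \<forall>i. x i \<in> C}"
  have P: "?P \<subseteq> carrier RP" using C_powers_in_RP by auto
  have eq: "?P = {x \<in> topspace TRP. (\<lambda>i. C #> x i) \<in> {\<lambda>i. C}}"
    using P C_subset coset_C coset_join1[OF _ _ subgroup_C] by (auto simp: topspace_RP carrier_RP fun_eq_iff)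
  have "openin TRP ?P"
    unfolding eq by (rule openin_continuous_map_preimage[OF continuous_map_coset_RP]) simp
  moreover
  have C: "topspace (subtopology T C) = C" using C_subset by (auto simp: topspace_eq_carrier)
  have "compact_space (product_topology (\<lambda>i::nat. subtopology T C) UNIV)"
    using compactin_C by (simp add: compact_space_product_topology compact_space_subtopology)
  then have "compactin (product_topology (\<lambda>i::nat. subtopology T C) UNIV) ?P"
    unfolding compact_space_def topspace_product_topology C by (simp add: PiE_def Pi_def extensional_def)
  moreover have "continuous_map (product_topology (\<lambda>i::nat. subtopology T C) UNIV) TRP (\<lambda>x. x)"
  proof (rule continuous_map_into_RP)
    show "x \<in> carrier RP" if "x \<in> topspace (product_topology (\<lambda>i::nat. subtopology T C) UNIV)" for x
      using that C_powers_in_RP by (auto simp: C)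
    show "continuous_map (product_topology (\<lambda>i::nat. subtopology T C) UNIV) T (\<lambda>x. x k)" for k
      by (rule continuous_map_into_fulltopology) (rule continuous_map_product_projection, simp)
    have "continuous_map (product_topology (\<lambda>i::nat. subtopology T C) UNIV) (discrete_topology UNIV)
        (\<lambda>x i::nat. C)" by simp
    then show "continuous_map (product_topology (\<lambda>i::nat. subtopology T C) UNIV) (discrete_topology UNIV)
        (\<lambda>x i. C #> x i)"
      by (rule continuous_map_eq) (auto simp: C coset_C PiE_iff)
  qed
  ultimately have "openin TRP ?P" "compactin TRP ?P" using image_compactin by fastforce+
  then show ?thesis
    by (rule R.locally_compact_spaceI_unit) (use subgroup.one_closed[OF subgroup_C] in \<open>auto simp: one_RP\<close>)
qed

lemma Hausdorff_RP:
  assumes "Hausdorff_space T"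
  shows "Hausdorff_space TRP"
proof (rule Hausdorff_space_injective_preimage)
  show "Hausdorff_space (product_topology (\<lambda>i::nat. T) UNIV)"
    using assms by (simp add: Hausdorff_space_product_topology)
  show "continuous_map TRP (product_topology (\<lambda>i::nat. T) UNIV) (\<lambda>x. x)"
    by (simp add: continuous_map_componentwise_UNIV continuous_map_proj_RP)
qed simp

text \<open>On the open subgroup of sequences in \<open>C\<close> the topology is that of the
  product, so finitely many coordinates decide, and one \<open>V\<close> can serve them all.\<close>

lemma unit_neighborhood_RP:
  assumes "openin TRP U" "\<one>\<^bsub>RP\<^esub> \<in> U"
  obtains F V where "finite F" "openin T V" "\<one> \<in> V"
    "\<And>x. \<lbrakk>\<And>i. x i \<in> C; \<And>i. i \<in> F \<Longrightarrow> x i \<in> V\<rbrakk> \<Longrightarrow> x \<in> U"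
proof -
  obtain Z where Z: "openin (prod_topology (product_topology (\<lambda>i. T) UNIV) (discrete_topology UNIV)) Z"
    "U = (\<lambda>x. (x, \<lambda>i. C #> x i)) -` Z \<inter> carrier RP"
    using assms(1) unfolding restricted_power_topology_def openin_pullback_topology by blast
  have "((\<lambda>i. \<one>), (\<lambda>i. C)) \<in> Z"
    using assms(2) subgroup.one_closed[OF subgroup_C] unfolding Z(2) one_RP by (simp add: coset_C)
  then obtain Z1 Z2 where Z12: "openin (product_topology (\<lambda>i. T) UNIV) Z1" "(\<lambda>i. \<one>) \<in> Z1" "(\<lambda>i. C) \<in> Z2"
    "Z1 \<times> Z2 \<subseteq> Z"
    using openin_prod_topologyE[OF Z(1)] by metis
  obtain B where B: "finite {i. B i \<noteq> carrier A}" "\<And>i. openin T (B i)" "\<And>i. \<one> \<in> B i"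
     "PiE UNIV B \<subseteq> Z1"
    using Z12(1,2) unfolding openin_product_topology_alt by (fastforce simp: topspace_eq_carrier PiE_iff)
  let ?F = "{i. B i \<noteq> carrier A}"
  show ?thesis
  proof
    show "finite ?F" by (rule B)
    \<comment> \<open>Intersecting with \<open>topspace T\<close> matters if \<open>?F\<close> is
      empty, where the bare intersection would be the whole type.\<close>
    show "openin T ((\<Inter>i\<in>?F. B i) \<inter> topspace T)" by (intro openin_INT B)
    show "\<one> \<in> (\<Inter>i\<in>?F. B i) \<inter> topspace T" using B(3) by (auto simp: topspace_eq_carrier)
    fix x assume x: "\<And>i. x i \<in> C" "\<And>i. i \<in> ?F \<Longrightarrow> x i \<in> (\<Inter>i\<in>?F. B i) \<inter> topspace T"
    have "x i \<in> B i" for i using x(2)[of i] x(1)[of i] C_subset by (cases "i \<in> ?F") auto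
    then have "x \<in> Z1" using B(4) by auto
    moreover have "(\<lambda>i. C #> x i) = (\<lambda>i. C)" using x(1) by (simp add: coset_C)
    ultimately show "x \<in> U" unfolding Z(2) using Z12(3,4) C_powers_in_RP x(1) by auto
  qed
qed

end

section \<open>Elementary automorphisms of restricted powers\<close>

context compact_open_subgroup
begin

lemma transvection_closed:
  assumes "x \<in> carrier RP"
  shows "transvection A C i j b x \<in> carrier RP"
proof -
  let ?y = "x(i := x i \<otimes> (if b then x j else inv x j))"
  have "{k. ?y k \<notin> C} \<subseteq> insert i {k. x k \<notin> C}" by auto
  moreover have "finite (insert i {k. x k \<notin> C})" using assms by (simp add: carrier_RP)
  ultimately have "finite {k. ?y k \<notin> C}" by (rule finite_subset)
  moreover have "?y k \<in> carrier A" for k using assms by (simp add: carrier_RP)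
  ultimately have "?y \<in> carrier RP" unfolding carrier_RP by blast
  then show ?thesis using assms by (simp add: transvection_def)
qed

lemma transvection_cancel:
  assumes "i \<noteq> j"
  shows "transvection A C i j (\<not> b) \<circ> transvection A C i j b = id"
proof
  fix x
  show "(transvection A C i j (\<not> b) \<circ> transvection A C i j b) x = id x"
  proof (cases "x \<in> carrier RP")
    case True
    then have "x i \<in> carrier A" "x j \<in> carrier A" by (auto simp: carrier_RP)
    with True assms show ?thesis using transvection_closed[OF True, of i j b]
      by (auto simp: transvection_def m_assoc)
  qed (simp add: transvection_def)
qed

lemma transvection_hom:
  shows "transvection A C i j b \<in> hom RP RP"
proof (rule homI)
  fix x y assume xy: "x \<in> carrier RP" "y \<in> carrier RP"
  then have "x \<otimes>\<^bsub>RP\<^esub> y \<in> carrier RP" unfolding mult_RP by (rule mult_mem_RP)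
  with xy show "transvection A C i j b (x \<otimes>\<^bsub>RP\<^esub> y) = transvection A C i j b x \<otimes>\<^bsub>RP\<^esub> transvection A C i j b y"
    by (auto simp: transvection_def mult_RP carrier_RP fun_eq_iff inv_mult m_ac)
qed (rule transvection_closed)

lemma transvection_continuous: "continuous_map TRP TRP (transvection A C i j b)"
proof -
  let ?t = "\<lambda>x. x(i := x i \<otimes> (if b then x j else inv x j))"
  have t: "?t x \<in> carrier RP" if "x \<in> carrier RP" for x
    using transvection_closed[OF that, of i j b] that by (simp add: transvection_def)
  have "continuous_map TRP TRP ?t"
  proof (rule continuous_map_into_RP)
    show "?t x \<in> carrier RP" if "x \<in> topspace TRP" for x using t that by (simp add: topspace_RP)
    have "continuous_map TRP T (\<lambda>x. x i \<otimes> (if b then x j else inv x j))"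
      by (cases b) (auto intro!: continuous_map_mult continuous_map_m_inv continuous_map_proj_RP)
    then show "continuous_map TRP T (\<lambda>x. ?t x k)" for k
      by (cases "k = i") (auto intro: continuous_map_proj_RP)
    have "continuous_map TRP (discrete_topology UNIV)
        (\<lambda>x. (\<lambda>k. C #> x k)(i := (C #> x i) <#> (if b then C #> x j else set_inv (C #> x j))))"
      by (rule continuous_map_discrete_combine[where
            h = "\<lambda>a a'. a(i := a i <#> (if b then a j else set_inv (a j)))",
            OF continuous_map_coset_RP continuous_map_coset_RP])
    then show "continuous_map TRP (discrete_topology UNIV) (\<lambda>x k. C #> ?t x k)"
      by (rule continuous_map_eq) (auto simp: topspace_RP carrier_RP coset_mult coset_inv fun_eq_iff)
  qed
  then show ?thesis by (rule continuous_map_eq) (simp add: topspace_RP transvection_def)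
qed

text \<open>Two indices whose terms lie in the same translate \<open>s W\<close> suffice:
  \<open>s\<close> cancels in the quotient, which lies in \<open>W <#> W\<close> by symmetry of
  \<open>W\<close>.\<close>

lemma infinite_pigeonhole:
  assumes V: "openin T V" "\<one> \<in> V" and x: "\<And>i. x i \<in> C" and I: "infinite (I :: nat set)"
  obtains i j where "i \<in> I" "j \<in> I" "i \<noteq> j" "x i \<otimes> inv x j \<in> V"
proof -
  obtain W where W: "openin T W" "\<one> \<in> W" "\<And>x. x \<in> W \<Longrightarrow> inv x \<in> W" "\<And>x y. \<lbrakk>x \<in> W; y \<in> W\<rbrakk> \<Longrightarrow> x \<otimes> y \<in> V"
    using small_unit_neighborhood[OF V] by metis
  have Wc: "W \<subseteq> carrier A" using W openin_subset_carrier by blast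
  obtain S where S: "finite S" "S \<subseteq> C" "C \<subseteq> S <#> W"
    by (rule compact_finite_translates[OF compactin_C W(1,2)])
  have "\<exists>s\<in>S. \<exists>w\<in>W. x i = s \<otimes> w" for i
    using subsetD[OF S(3) x[of i]] by (rule set_multE) blast
  then obtain s w where s: "\<And>i. s i \<in> S" "\<And>i. w i \<in> W" "\<And>i. x i = s i \<otimes> w i" by metis
  have "finite (s ` I)" using S(1) s(1) by (auto intro: finite_subset)
  from pigeonhole_infinite[OF I this] obtain i where i: "i \<in> I" "infinite {a \<in> I. s a = s i}" by auto
  then have "infinite ({a \<in> I. s a = s i} - {i})" by simp
  then have "{a \<in> I. s a = s i} - {i} \<noteq> {}" by (metis finite.emptyI)
  then obtain j where j: "j \<in> I" "s j = s i" "i \<noteq> j" by blast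
  have c: "s i \<in> carrier A" "w i \<in> carrier A" "w j \<in> carrier A" using s(1,2) S(2) C_subset Wc by (meson subsetD)+
  have "(s i \<otimes> w i) \<otimes> inv (s i \<otimes> w j) = w i \<otimes> inv w j"
  proof -
    have "(s i \<otimes> w i) \<otimes> inv (s i \<otimes> w j) = s i \<otimes> (w i \<otimes> inv w j) \<otimes> inv s i"
      using c by (simp add: inv_mult m_ac)
    also have "\<dots> = inv s i \<otimes> (s i \<otimes> (w i \<otimes> inv w j))" using c by (simp add: m_comm)
    also have "\<dots> = w i \<otimes> inv w j" using c by (simp add: m_assoc[symmetric])
    finally show ?thesis .
  qed
  then have "x i \<otimes> inv x j \<in> V" using W(3,4) s j(2) by metis
  then show ?thesis using that i j by blast
qed

end

text \<open>The submonoid generated by \<open>\<Gamma>\<close> under composition. Its elements are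
  words in \<open>\<Gamma>\<close>, hence countably many when \<open>\<Gamma>\<close> is countable,
  and it is a group once \<open>\<Gamma>\<close> contains inverses.\<close>

inductive_set compositions :: "('a \<Rightarrow> 'a) set \<Rightarrow> ('a \<Rightarrow> 'a) set" for \<Gamma> where
  id: "id \<in> compositions \<Gamma>"
| step: "\<lbrakk>\<gamma> \<in> \<Gamma>; q \<in> compositions \<Gamma>\<rbrakk> \<Longrightarrow> \<gamma> \<circ> q \<in> compositions \<Gamma>"

lemma compositions_incl: "\<gamma> \<in> \<Gamma> \<Longrightarrow> \<gamma> \<in> compositions \<Gamma>"
  using compositions.step[OF _ compositions.id, of \<gamma>] by simp

lemma compositions_comp: "\<lbrakk>p \<in> compositions \<Gamma>; q \<in> compositions \<Gamma>\<rbrakk> \<Longrightarrow> p \<circ> q \<in> compositions \<Gamma>"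
  by (induction p rule: compositions.induct) (auto simp: comp_assoc intro: compositions.step)

lemma countable_compositions:
  assumes "countable \<Gamma>"
  shows "countable (compositions \<Gamma>)"
proof (rule countable_subset)
  show "compositions \<Gamma> \<subseteq> (\<lambda>xs. foldr (\<circ>) xs id) ` lists \<Gamma>"
  proof
    fix q assume "q \<in> compositions \<Gamma>"
    then show "q \<in> (\<lambda>xs. foldr (\<circ>) xs id) ` lists \<Gamma>"
    proof induction
      case id
      show ?case by (rule image_eqI[of _ _ "[]"]) auto
    next
      case (step \<gamma> q)
      then obtain xs where "xs \<in> lists \<Gamma>" "q = foldr (\<circ>) xs id" by blast
      then have "\<gamma> \<circ> q = foldr (\<circ>) (\<gamma> # xs) id" "\<gamma> # xs \<in> lists \<Gamma>" using step(1) by (simp_all only: foldr.simps comp_apply lists.Cons)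
      then show ?case by blast
    qed
  qed
  show "countable ((\<lambda>xs. foldr (\<circ>) xs id) ` lists \<Gamma>)" using assms by simp
qed

lemma compositions_inverse:
  assumes "\<And>\<gamma>. \<gamma> \<in> \<Gamma> \<Longrightarrow> \<exists>\<gamma>'\<in>\<Gamma>. \<gamma> \<circ> \<gamma>' = id \<and> \<gamma>' \<circ> \<gamma> = id" "q \<in> compositions \<Gamma>"
  shows "\<exists>q'\<in>compositions \<Gamma>. q \<circ> q' = id \<and> q' \<circ> q = id"
  using assms(2)
proof induction
  case id
  show ?case by (intro bexI[OF _ compositions.id]) simp
next
  case (step \<gamma> q)
  then obtain \<gamma>' q' where *: "\<gamma>' \<in> \<Gamma>" "\<gamma> \<circ> \<gamma>' = id" "\<gamma>' \<circ> \<gamma> = id"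
    "q' \<in> compositions \<Gamma>" "q \<circ> q' = id" "q' \<circ> q = id" using assms(1) by metis
  have "q' \<circ> \<gamma>' \<in> compositions \<Gamma>" using * by (auto intro: compositions_comp compositions_incl)
  moreover have "(\<gamma> \<circ> q) \<circ> (q' \<circ> \<gamma>') = id" "(q' \<circ> \<gamma>') \<circ> (\<gamma> \<circ> q) = id"
    using * by (simp_all add: fun_eq_iff)
  ultimately show ?case by blast
qed

context compact_open_subgroup
begin

text \<open>The condition \<open>i \<noteq> j\<close> makes each generator invertible, with the
  transvection of opposite sign as inverse.\<close>

definition elementary_maps :: "((nat \<Rightarrow> 'a) \<Rightarrow> nat \<Rightarrow> 'a) set" where
  "elementary_maps = compositions {transvection A C i j b | i j b. i \<noteq> j}"

lemma countable_elementary_maps: "countable elementary_maps"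
proof -
  have "{transvection A C i j b | i j b. i \<noteq> j} \<subseteq> (\<lambda>(i, j, b). transvection A C i j b) ` UNIV"
    by (auto intro!: image_eqI[where x = "(_, _, _)"])
  then show ?thesis unfolding elementary_maps_def
    by (intro countable_compositions) (rule countable_subset, auto)
qed

lemma elementary_maps_comp:
  "\<lbrakk>p \<in> elementary_maps; q \<in> elementary_maps\<rbrakk> \<Longrightarrow> p \<circ> q \<in> elementary_maps"
  unfolding elementary_maps_def by (rule compositions_comp)

lemma elementary_maps_inverse:
  assumes "q \<in> elementary_maps"
  shows "\<exists>q'\<in>elementary_maps. q \<circ> q' = id \<and> q' \<circ> q = id"
  using assms unfolding elementary_maps_def
proof (rule compositions_inverse[rotated])
  fix \<gamma> assume "\<gamma> \<in> {transvection A C i j b | i j b. i \<noteq> j}"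
  then obtain i j b where "\<gamma> = transvection A C i j b" "i \<noteq> j" by blast
  then show "\<exists>\<gamma>'\<in>{transvection A C i j b | i j b. i \<noteq> j}. \<gamma> \<circ> \<gamma>' = id \<and> \<gamma>' \<circ> \<gamma> = id"
    using transvection_cancel[of i j b] transvection_cancel[of i j "\<not> b"]
    by (intro bexI[of _ "transvection A C i j (\<not> b)"]) auto
qed

lemma elementary_maps_hom_continuous:
  assumes "q \<in> elementary_maps"
  shows "q \<in> hom RP RP" "continuous_map TRP TRP q"
proof -
  have "q \<in> hom RP RP \<and> continuous_map TRP TRP q"
    using assms unfolding elementary_maps_def
  proof induction
    case id
    show ?case by (auto simp: hom_def)
  next
    case (step \<gamma> q)
    then obtain i j b where \<gamma>: "\<gamma> = transvection A C i j b" by blast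
    have "\<gamma> \<circ> q \<in> hom RP RP"
      unfolding \<gamma> by (rule Group.hom_compose[OF conjunct1[OF step.IH] transvection_hom])
    moreover have "continuous_map TRP TRP (\<gamma> \<circ> q)"
      unfolding \<gamma> by (rule continuous_map_compose[OF conjunct2[OF step.IH] transvection_continuous])
    ultimately show ?case ..
  qed
  then show "q \<in> hom RP RP" "continuous_map TRP TRP q" by auto
qed

text \<open>Writing \<open>(x\<^sub>f, x\<^sub>i)\<close> for two coordinates, the first three transvections are
  \<open>(x\<^sub>f, x\<^sub>i) \<mapsto> (x\<^sub>f x\<^sub>i, x\<^sub>i) \<mapsto> (x\<^sub>f x\<^sub>i, x\<^sub>f\<inverse>) \<mapsto> (x\<^sub>i, x\<^sub>f\<inverse>)\<close>.\<close>

lemma elementary_map_difference: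
  assumes "distinct [f, i, j]" "\<And>k. x k \<in> C"
  shows "\<exists>q\<in>elementary_maps. (\<forall>k. q x k \<in> C) \<and> q x f = x i \<otimes> inv x j \<and> (\<forall>k. k \<notin> {f, i} \<longrightarrow> q x k = x k)"
proof -
  have t: "transvection A C a b c \<in> elementary_maps" if "a \<noteq> b" for a b c
    unfolding elementary_maps_def using that by (intro compositions_incl) blast
  \<comment> \<open>Once coordinate \<open>f\<close> holds the old \<open>x i\<close>,
    \<open>?q4\<close> divides it by coordinate \<open>j\<close>, which the other maps leave
    alone.\<close>
  let ?q1 = "transvection A C f i True" and ?q2 = "transvection A C i f False"
    and ?q3 = "transvection A C f i True" and ?q4 = "transvection A C f j False"
  have c: "x k \<in> carrier A" for k using assms(2) C_subset by blast
  have step: "transvection A C a b True y = y(a := y a \<otimes> y b)" "transvection A C a b False y = y(a := y a \<otimes> inv y b)"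
    if "\<And>k. y k \<in> C" for y a b
    using C_powers_in_RP[OF that] by (simp_all add: transvection_def)
  note cl = subgroup.m_closed[OF subgroup_C] subgroup.m_inv_closed[OF subgroup_C]
  define y1 where "y1 = x(f := x f \<otimes> x i)"
  define y2 where "y2 = y1(i := y1 i \<otimes> inv y1 f)"
  define y3 where "y3 = y2(f := y2 f \<otimes> y2 i)"
  define y4 where "y4 = y3(f := y3 f \<otimes> inv y3 j)"
  have C1: "y1 k \<in> C" for k using assms(2) cl by (simp add: y1_def)
  have C2: "y2 k \<in> C" for k using C1 cl by (simp add: y2_def)
  have C3: "y3 k \<in> C" for k using C2 cl by (simp add: y3_def)
  have C4: "y4 k \<in> C" for k using C3 cl by (simp add: y4_def)
  have eq: "(?q4 \<circ> ?q3 \<circ> ?q2 \<circ> ?q1) x = y4"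
    using assms(2) C1 C2 C3 by (simp add: step y1_def y2_def y3_def y4_def del: fun_upd_apply)
  have "y4 f = (x f \<otimes> x i) \<otimes> (x i \<otimes> inv (x f \<otimes> x i)) \<otimes> inv x j"
    using assms(1) by (simp add: y1_def y2_def y3_def y4_def)
  also have "(x f \<otimes> x i) \<otimes> (x i \<otimes> inv (x f \<otimes> x i)) = x i"
    using c by (metis inv_closed inv_solve_right' m_assoc m_closed m_comm)
  finally have "y4 f = x i \<otimes> inv x j" .
  moreover have "y4 k = x k" if "k \<notin> {f, i}" for k
    using that by (simp add: y1_def y2_def y3_def y4_def)
  moreover have "?q4 \<circ> ?q3 \<circ> ?q2 \<circ> ?q1 \<in> elementary_maps"
    by (intro elementary_maps_comp t) (use assms(1) in auto)
  ultimately show ?thesis using eq C4 by metis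
qed

text \<open>One coordinate of \<open>F\<close> is treated at a time. The indices \<open>i\<close>
  and \<open>j\<close> are taken outside \<open>insert f F\<close>; only \<open>f\<close> and
  \<open>i\<close> change, so the coordinates that are already small stay so.\<close>

lemma elementary_map_small:
  assumes V: "openin T V" "\<one> \<in> V" and x: "\<And>i. x i \<in> C" and "finite F"
  shows "\<exists>q\<in>elementary_maps. (\<forall>i. q x i \<in> C) \<and> (\<forall>f\<in>F. q x f \<in> V)"
  using \<open>finite F\<close>
proof (induction F)
  case empty
  show ?case using x by (intro bexI[of _ id]) (auto simp: elementary_maps_def intro: compositions.id)
next
  case (insert f F)
  then obtain q where q: "q \<in> elementary_maps" "\<And>i. q x i \<in> C" "\<And>f. f \<in> F \<Longrightarrow> q x f \<in> V" by blast
  have inf: "infinite (- insert f F)" using insert.hyps by (simp add: Compl_eq_Diff_UNIV)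
  obtain i j where "i \<in> - insert f F" "j \<in> - insert f F" and
    ij: "i \<noteq> j" "q x i \<otimes> inv q x j \<in> V"
    by (rule infinite_pigeonhole[where x = "q x", OF V q(2) inf])
  then have ij': "i \<notin> insert f F" "j \<notin> insert f F" by simp_all
  with ij(1) have dist: "distinct [f, i, j]" by auto
  obtain p where p: "p \<in> elementary_maps"
    "\<And>k. p (q x) k \<in> C" "p (q x) f = q x i \<otimes> inv q x j" "\<And>k. k \<notin> {f, i} \<Longrightarrow> p (q x) k = q x k"
    using elementary_map_difference[where x = "q x", OF dist q(2)] by blast
  have "p \<circ> q \<in> elementary_maps" using p(1) q(1) by (rule elementary_maps_comp)
  moreover have "(p \<circ> q) x k \<in> V" if "k \<in> insert f F" for k
  proof (cases "k = f")
    case True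
    then show ?thesis using p(3) ij(2) by simp
  next
    case False
    then have "k \<in> F" "k \<notin> {f, i}" using that ij'(1) by auto
    then show ?thesis using p(4) q(3) by simp
  qed
  ultimately show ?case using p(2) by (intro bexI[of _ "p \<circ> q"]) auto
qed

end

section \<open>Semidirect products with countable groups of automorphisms\<close>

definition semidirect :: "('a, 'b) monoid_scheme \<Rightarrow> ('a \<Rightarrow> 'a) set \<Rightarrow> ('a \<times> ('a \<Rightarrow> 'a)) monoid" where
  "semidirect H Q =
    \<lparr>carrier = carrier H \<times> Q, mult = \<lambda>(h, p) (k, q). (h \<otimes>\<^bsub>H\<^esub> p k, p \<circ> q), one = (\<one>\<^bsub>H\<^esub>, id)\<rparr>"

text \<open>Elements of \<open>Q\<close> are permutations of the whole type, so identities in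
  \<open>Q\<close> are plain equalities of functions.\<close>

locale automorphism_action = topological_comm_group H T for H (structure) and T +
  fixes Q :: "('a \<Rightarrow> 'a) set"
  assumes countable_Q: "countable Q"
    and id_Q: "id \<in> Q"
    and comp_Q: "\<lbrakk>p \<in> Q; q \<in> Q\<rbrakk> \<Longrightarrow> p \<circ> q \<in> Q"
    and inverse_Q: "q \<in> Q \<Longrightarrow> \<exists>q'\<in>Q. q \<circ> q' = id \<and> q' \<circ> q = id"
    and hom_Q: "q \<in> Q \<Longrightarrow> q \<in> hom H H"
    and continuous_Q: "q \<in> Q \<Longrightarrow> continuous_map T T q"
begin

abbreviation "E \<equiv> semidirect H Q"
abbreviation "TE \<equiv> prod_topology T (discrete_topology Q)"

lemma carrier_E: "carrier E = carrier H \<times> Q"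
  by (simp add: semidirect_def)

lemma mult_E: "(h, p) \<otimes>\<^bsub>E\<^esub> (k, q) = (h \<otimes> p k, p \<circ> q)"
  by (simp add: semidirect_def)

lemma one_E: "\<one>\<^bsub>E\<^esub> = (\<one>, id)"
  by (simp add: semidirect_def)

lemma Q_closed: "\<lbrakk>q \<in> Q; h \<in> carrier H\<rbrakk> \<Longrightarrow> q h \<in> carrier H"
  using hom_Q hom_in_carrier by metis

lemma Q_mult: "\<lbrakk>q \<in> Q; h \<in> carrier H; k \<in> carrier H\<rbrakk> \<Longrightarrow> q (h \<otimes> k) = q h \<otimes> q k"
  using hom_Q hom_mult by metis

lemma Q_one: "q \<in> Q \<Longrightarrow> q \<one> = \<one>"
  using hom_Q hom_one is_group by metis

definition inverse_of :: "('a \<Rightarrow> 'a) \<Rightarrow> 'a \<Rightarrow> 'a" where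
  "inverse_of q = (SOME q'. q' \<in> Q \<and> q \<circ> q' = id \<and> q' \<circ> q = id)"

lemma inverse_of:
  assumes "q \<in> Q"
  shows "inverse_of q \<in> Q" "q \<circ> inverse_of q = id" "inverse_of q \<circ> q = id"
proof -
  have "\<exists>q'. q' \<in> Q \<and> q \<circ> q' = id \<and> q' \<circ> q = id" using inverse_Q[OF assms] by blast
  from someI_ex[OF this] show "inverse_of q \<in> Q" "q \<circ> inverse_of q = id" "inverse_of q \<circ> q = id"
    unfolding inverse_of_def by blast+
qed

lemma inverse_mult:
  assumes "h \<in> carrier H" "p \<in> Q"
  shows "(inverse_of p (inv h), inverse_of p) \<otimes>\<^bsub>E\<^esub> (h, p) = \<one>\<^bsub>E\<^esub>"
proof -
  have "inverse_of p (inv h) \<otimes> inverse_of p h = inverse_of p (inv h \<otimes> h)"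
    by (rule Q_mult[symmetric]) (use assms inverse_of(1) in auto)
  then show ?thesis using assms inverse_of by (simp add: mult_E one_E Q_one)
qed

lemma group_E: "group E"
proof (rule groupI)
  show "x \<otimes>\<^bsub>E\<^esub> y \<in> carrier E" if xy: "x \<in> carrier E" "y \<in> carrier E" for x y
  proof -
    obtain h p k q where "x = (h, p)" "y = (k, q)" by fastforce
    with xy show ?thesis by (simp add: mult_E carrier_E comp_Q Q_closed)
  qed
  show "\<one>\<^bsub>E\<^esub> \<in> carrier E" by (simp add: one_E carrier_E id_Q)
  show "x \<otimes>\<^bsub>E\<^esub> y \<otimes>\<^bsub>E\<^esub> z = x \<otimes>\<^bsub>E\<^esub> (y \<otimes>\<^bsub>E\<^esub> z)"
    if xyz: "x \<in> carrier E" "y \<in> carrier E" "z \<in> carrier E" for x y z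
  proof -
    obtain h p k q l r where "x = (h, p)" "y = (k, q)" "z = (l, r)" by (metis surj_pair)
    with xyz show ?thesis by (simp add: mult_E carrier_E Q_closed Q_mult m_assoc comp_assoc)
  qed
  show "\<one>\<^bsub>E\<^esub> \<otimes>\<^bsub>E\<^esub> x = x" if "x \<in> carrier E" for x
    using that by (auto simp: mult_E carrier_E one_E)
  show "\<exists>y\<in>carrier E. y \<otimes>\<^bsub>E\<^esub> x = \<one>\<^bsub>E\<^esub>" if x: "x \<in> carrier E" for x
  proof -
    obtain h p where hp: "x = (h, p)" by fastforce
    show ?thesis using x inverse_mult unfolding hp
      by (intro bexI[of _ "(inverse_of p (inv h), inverse_of p)"]) (auto simp: carrier_E inverse_of Q_closed)
  qed
qed

lemma inv_E:
  assumes "h \<in> carrier H" "p \<in> Q"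
  shows "inv\<^bsub>E\<^esub> (h, p) = (inverse_of p (inv h), inverse_of p)"
proof -
  interpret E: group E by (rule group_E)
  show ?thesis
    using E.inv_equality[OF inverse_mult[OF assms]] assms by (simp add: carrier_E inverse_of Q_closed)
qed

lemma topspace_E: "topspace TE = carrier E"
  by (simp add: carrier_E topspace_eq_carrier)

text \<open>As \<open>Q\<close> is discrete, the domain splits into open pieces on each of which the
  acting automorphism \<open>p\<close> is constant.\<close>

lemma continuous_map_apply:
  assumes "continuous_map X (discrete_topology Q) g" "continuous_map X T f"
  shows "continuous_map X T (\<lambda>x. g x (f x))"
  unfolding continuous_map
proof (intro conjI allI impI)
  have g: "g x \<in> Q" and f: "f x \<in> carrier H" if "x \<in> topspace X" for x
    using assms that by (auto simp: continuous_map_def topspace_eq_carrier)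
  show "(\<lambda>x. g x (f x)) ` topspace X \<subseteq> topspace T"
    using g f Q_closed by (auto simp: topspace_eq_carrier)
  fix U assume U: "openin T U"
  have "{x \<in> topspace X. g x (f x) \<in> U} =
    (\<Union>p\<in>Q. {x \<in> topspace X. g x \<in> {p}} \<inter> {x \<in> topspace X. (p \<circ> f) x \<in> U})"
    using g by auto
  moreover have "openin X ({x \<in> topspace X. g x \<in> {p}} \<inter> {x \<in> topspace X. (p \<circ> f) x \<in> U})" if "p \<in> Q" for p
    using that by (intro openin_Int openin_continuous_map_preimage[OF assms(1)]
        openin_continuous_map_preimage[OF continuous_map_compose[OF assms(2) continuous_Q] U]) auto
  ultimately show "openin X {x \<in> topspace X. g x (f x) \<in> U}" by auto
qed

lemma topological_group_E: "topological_group E TE"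
proof -
  interpret E: group E by (rule group_E)
  let ?P = "prod_topology TE TE"
  have 1: "continuous_map ?P T (\<lambda>z. fst (fst z))" and 2: "continuous_map ?P (discrete_topology Q) (\<lambda>z. snd (fst z))"
    and 3: "continuous_map ?P T (\<lambda>z. fst (snd z))" and 4: "continuous_map ?P (discrete_topology Q) (\<lambda>z. snd (snd z))"
    by (rule continuous_map_compose[OF continuous_map_fst continuous_map_fst, unfolded comp_def]
        continuous_map_compose[OF continuous_map_fst continuous_map_snd, unfolded comp_def]
        continuous_map_compose[OF continuous_map_snd continuous_map_fst, unfolded comp_def]
        continuous_map_compose[OF continuous_map_snd continuous_map_snd, unfolded comp_def])+
  have "continuous_map (prod_topology (discrete_topology Q) (discrete_topology Q)) (discrete_topology Q)
      (\<lambda>z. fst z \<circ> snd z)"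
    using comp_Q by (auto simp flip: prod_topology_discrete_topology)
  from continuous_map_compose[OF continuous_map_pairedI[OF 2 4] this]
  have "continuous_map ?P (discrete_topology Q) (\<lambda>z. snd (fst z) \<circ> snd (snd z))"
    by (simp only: comp_def fst_conv snd_conv)
  then have "continuous_map ?P TE (\<lambda>z. (fst (fst z) \<otimes> snd (fst z) (fst (snd z)), snd (fst z) \<circ> snd (snd z)))"
    by (rule continuous_map_pairedI[OF continuous_map_mult[OF 1 continuous_map_apply[OF 2 3]]])
  then have m: "continuous_map ?P TE (\<lambda>(x, y). x \<otimes>\<^bsub>E\<^esub> y)"
    by (rule continuous_map_eq) (auto simp: mult_E)
  have i: "continuous_map TE (discrete_topology Q) (\<lambda>z. inverse_of (snd z))"
    by (rule continuous_map_compose[OF continuous_map_snd, unfolded o_def]) (auto simp: inverse_of)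
  then have "continuous_map TE TE (\<lambda>z. (inverse_of (snd z) (inv (fst z)), inverse_of (snd z)))"
    using continuous_map_pairedI[OF continuous_map_apply[OF i continuous_map_m_inv[OF continuous_map_fst]] i]
    by blast
  then have "continuous_map TE TE (\<lambda>x. inv\<^bsub>E\<^esub> x)"
    by (rule continuous_map_eq) (auto simp: inv_E topspace_eq_carrier)
  with m show ?thesis by unfold_locales (simp_all add: carrier_E topspace_eq_carrier)
qed

lemma locally_compact_E: "locally_compact_space T \<Longrightarrow> locally_compact_space TE"
  by (simp add: locally_compact_space_prod_topology locally_compact_space_discrete_topology)

lemma Hausdorff_E: "Hausdorff_space T \<Longrightarrow> Hausdorff_space TE"
  by (simp add: Hausdorff_space_prod_topology)

text \<open>The normal subgroup is the kernel of the projection to \<open>Q\<close>: closed because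
  \<open>Q\<close> is discrete, and its cosets are represented by the pairs
  \<open>(\<one>, p)\<close>.\<close>

lemma abelian_by_countable_E: "abelian_by_countable E TE"
proof -
  interpret E: topological_group E TE by (rule topological_group_E)
  let ?N = "carrier H \<times> {id :: 'a \<Rightarrow> 'a}"
  have N: "subgroup ?N E"
  proof (rule E.subgroupI)
    show "inv\<^bsub>E\<^esub> a \<in> ?N" if a: "a \<in> ?N" for a
    proof -
      obtain h where h: "a = (h, id)" "h \<in> carrier H" using a by blast
      have "inverse_of id = id" using inverse_of(2)[OF id_Q] by simp
      with h show ?thesis by (simp add: inv_E id_Q)
    qed
  qed (auto simp: carrier_E id_Q mult_E)
  have "closedin TE {z \<in> topspace TE. snd z \<in> {id}}"
    by (rule closedin_continuous_map_preimage[OF continuous_map_snd]) (simp add: id_Q)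
  moreover have "{z \<in> topspace TE. snd z \<in> {id}} = ?N" using id_Q by (auto simp: topspace_eq_carrier)
  ultimately have "closedin TE ?N" by simp
  moreover
  have normal: "?N \<lhd> E"
    unfolding E.normal_inv_iff
  proof (intro conjI ballI N)
    fix x a assume "x \<in> carrier E" "a \<in> ?N"
    then obtain h p k where "x = (h, p)" "a = (k, id)" "h \<in> carrier H" "p \<in> Q" "k \<in> carrier H"
      by (auto simp: carrier_E)
    then show "x \<otimes>\<^bsub>E\<^esub> a \<otimes>\<^bsub>E\<^esub> inv\<^bsub>E\<^esub> x \<in> ?N"
      by (simp add: inv_E mult_E inverse_of Q_closed)
  qed
  moreover have "comm_group (E\<lparr>carrier := ?N\<rparr>)"
    by (rule group.group_comm_groupI[OF E.subgroup_imp_group[OF N]]) (auto simp: mult_E m_comm)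
  moreover have "carrier (E Mod ?N) \<subseteq> (\<lambda>p. ?N #>\<^bsub>E\<^esub> (\<one>, p)) ` Q"
  proof
    fix X assume "X \<in> carrier (E Mod ?N)"
    then obtain h p where X: "X = ?N #>\<^bsub>E\<^esub> (h, p)" "h \<in> carrier H" "p \<in> Q"
      by (auto simp: carrier_FactGroup carrier_E)
    have "(h, p) = (h, id) \<otimes>\<^bsub>E\<^esub> (\<one>, p)" using X by (simp add: mult_E)
    moreover have "(h, id) \<in> ?N" using X by simp
    ultimately have "(h, p) \<in> ?N #>\<^bsub>E\<^esub> (\<one>, p)" unfolding r_coset_def by blast
    then have "?N #>\<^bsub>E\<^esub> (\<one>, p) = X"
      unfolding X(1) using X(3) by (intro E.repr_independence[OF _ _ N]) (auto simp: carrier_E)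
    with X(3) show "X \<in> (\<lambda>p. ?N #>\<^bsub>E\<^esub> (\<one>, p)) ` Q" by blast
  qed
  then have "countable (carrier (E Mod ?N))" by (rule countable_subset) (simp add: countable_Q)
  ultimately show ?thesis unfolding abelian_by_countable_def by blast
qed

text \<open>With \<open>u = q (h \<otimes> s)\<close> one has \<open>(h, p) = (s\<inverse>, q\<inverse>) \<otimes> (u, 1) \<otimes> (1, q p)\<close>.\<close>

lemma duoseparable_E:
  assumes S: "countable S" "S \<subseteq> carrier H"
    and small: "\<And>U h. \<lbrakk>openin T U; \<one> \<in> U; h \<in> carrier H\<rbrakk> \<Longrightarrow> \<exists>s\<in>S. \<exists>q\<in>Q. q (h \<otimes> s) \<in> U"
  shows "duoseparable E TE"
proof -
  interpret E: topological_group E TE by (rule topological_group_E)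
  \<comment> \<open>The inverses of \<open>S\<close> serve the left factor; \<open>\<one>\<close> is
    added for the right factor \<open>(\<one>, q \<circ> p)\<close>.\<close>
  let ?S = "insert \<one> ((\<lambda>s. inv s) ` S) \<times> Q"
  have Sc: "?S \<subseteq> carrier E" using S(2) by (auto simp: carrier_E)
  have "carrier E = ?S <#>\<^bsub>E\<^esub> U <#>\<^bsub>E\<^esub> ?S" if U: "unit_neighborhood E TE U" for U
  proof
    have Uc: "U \<subseteq> carrier E" using U by (simp add: unit_neighborhood_def)
    show "?S <#>\<^bsub>E\<^esub> U <#>\<^bsub>E\<^esub> ?S \<subseteq> carrier E" by (intro E.set_mult_closed Sc Uc)
    obtain V where V: "openin TE V" "(\<one>, id) \<in> V" "V \<subseteq> U"
      using U unfolding unit_neighborhood_def one_E by blast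
    obtain A B where AB: "openin T A" "\<one> \<in> A" "id \<in> B" "A \<times> B \<subseteq> V"
      by (rule openin_prod_topologyE[OF V(1,2)])
    show "carrier E \<subseteq> ?S <#>\<^bsub>E\<^esub> U <#>\<^bsub>E\<^esub> ?S"
    proof
      fix x assume "x \<in> carrier E"
      then obtain h p where x: "x = (h, p)" "h \<in> carrier H" "p \<in> Q" by (auto simp: carrier_E)
      obtain s q where s: "s \<in> S" "q \<in> Q" "q (h \<otimes> s) \<in> A" using small[OF AB(1,2) x(2)] by blast
      have sc: "s \<in> carrier H" using s S by blast
      have "inverse_of q (q y) = y" "(inverse_of q \<circ> (q \<circ> p)) = p" for y
        using inverse_of(3)[OF s(2)] by (simp_all add: fun_eq_iff)
      then have "x = (inv s, inverse_of q) \<otimes>\<^bsub>E\<^esub> (q (h \<otimes> s), id) \<otimes>\<^bsub>E\<^esub> (\<one>, q \<circ> p)"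
        using x sc s by (simp add: mult_E Q_one inverse_of) (simp add: m_comm[of h s] m_assoc[symmetric])
      moreover have "(q (h \<otimes> s), id) \<in> U" using s(3) AB(3,4) V(3) by blast
      ultimately show "x \<in> ?S <#>\<^bsub>E\<^esub> U <#>\<^bsub>E\<^esub> ?S"
        using s x by (auto intro!: set_multI simp: inverse_of comp_Q)
    qed
  qed
  then show ?thesis unfolding duoseparable_def using S(1) countable_Q Sc by (intro exI[of _ ?S]) auto
qed

end

section \<open>Products and transport of structure\<close>

lemma topological_comm_group_DirProd:
  assumes "topological_comm_group G T" "topological_comm_group H U"
  shows "topological_comm_group (G \<times>\<times> H) (prod_topology T U)"
proof -
  interpret G: topological_comm_group G T by fact
  interpret H: topological_comm_group H U by fact
  interpret D: group "G \<times>\<times> H" by (intro DirProd_group G.is_group H.is_group)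
  let ?X = "prod_topology T U"
  let ?P = "prod_topology ?X ?X"
  note c = continuous_map_compose[unfolded comp_def]
  have 1: "continuous_map ?P ?X (\<lambda>z. (fst (fst z) \<otimes>\<^bsub>G\<^esub> fst (snd z), snd (fst z) \<otimes>\<^bsub>H\<^esub> snd (snd z)))"
    by (rule continuous_map_pairedI[OF
          G.continuous_map_mult[OF c[OF continuous_map_fst continuous_map_fst] c[OF continuous_map_snd continuous_map_fst]]
          H.continuous_map_mult[OF c[OF continuous_map_fst continuous_map_snd] c[OF continuous_map_snd continuous_map_snd]]])
  have "continuous_map ?X ?X (\<lambda>z. (inv\<^bsub>G\<^esub> fst z, inv\<^bsub>H\<^esub> snd z))"
    by (rule continuous_map_pairedI[OF G.continuous_map_m_inv[OF continuous_map_fst]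
          H.continuous_map_m_inv[OF continuous_map_snd]])
  then have "continuous_map ?X ?X (\<lambda>z. inv\<^bsub>G \<times>\<times> H\<^esub> z)"
    by (rule continuous_map_eq)
      (auto simp: G.topspace_eq_carrier H.topspace_eq_carrier G.is_group H.is_group)
  with 1 show ?thesis
    by unfold_locales (auto simp: G.topspace_eq_carrier H.topspace_eq_carrier mult_DirProd' case_prod_unfold
        G.m_comm H.m_comm)
qed

lemma hom_DirProd_apsnd:
  assumes "q \<in> hom H H"
  shows "apsnd q \<in> hom (M \<times>\<times> H) (M \<times>\<times> H)"
  using assms by (auto simp: hom_def)

context compact_open_subgroup
begin

text \<open>Only finitely many terms of \<open>x\<close> lie outside \<open>C\<close>, so a finite
  list of corrections from \<open>S\<close>, continued by \<open>\<one>\<close>, moves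
  \<open>x\<close> into the power of \<open>C\<close>; there are countably many such lists.\<close>

lemma coset_representatives_RP:
  assumes S: "countable S" "S \<subseteq> carrier A" "\<And>a. a \<in> carrier A \<Longrightarrow> \<exists>s\<in>S. a \<otimes> s \<in> C"
  obtains R where "countable R" "R \<subseteq> carrier RP"
    "\<And>x. x \<in> carrier RP \<Longrightarrow> \<exists>y\<in>R. \<forall>i. (x \<otimes>\<^bsub>RP\<^esub> y) i \<in> C"
proof -
  define r where "r l i = (if i < length l then l ! i else \<one>)" for l and i :: nat
  obtain \<sigma> where \<sigma>: "\<And>a. a \<in> carrier A \<Longrightarrow> \<sigma> a \<in> S \<and> a \<otimes> \<sigma> a \<in> C" using S(3) by metis
  show ?thesis
  proof
    show "countable (r ` lists S)" using S(1) by simp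
    show "r ` lists S \<subseteq> carrier RP"
    proof (rule image_subsetI)
      fix l assume l: "l \<in> lists S"
      have "{i. r l i \<notin> C} \<subseteq> {..<length l}" using subgroup.one_closed[OF subgroup_C] by (auto simp: r_def)
      then have "finite {i. r l i \<notin> C}" by (rule finite_subset) simp
      moreover have "r l i \<in> carrier A" for i
        using l S(2) nth_mem[of i l] by (auto simp: r_def in_lists_conv_set)
      ultimately show "r l \<in> carrier RP" by (simp add: carrier_RP)
    qed
    fix x assume x: "x \<in> carrier RP"
    then have "finite {i. x i \<notin> C}" by (simp add: carrier_RP)
    then obtain n where n: "\<And>i. x i \<notin> C \<Longrightarrow> i < n" using finite_nat_set_iff_bounded by auto
    have xc: "x i \<in> carrier A" for i using x by (simp add: carrier_RP)
    let ?l = "map (\<lambda>i. \<sigma> (x i)) [0..<n]"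
    have "(x \<otimes>\<^bsub>RP\<^esub> r ?l) i \<in> C" for i
      using \<sigma>[OF xc[of i]] n[of i] xc[of i] by (auto simp: mult_RP r_def)
    moreover have "?l \<in> lists S" using \<sigma> xc by auto
    ultimately show "\<exists>y\<in>r ` lists S. \<forall>i. (x \<otimes>\<^bsub>RP\<^esub> y) i \<in> C" by blast
  qed
qed

text \<open>The action on \<open>M\<close> is trivial, since translations alone will handle that
  factor; hence \<open>apsnd\<close>.\<close>

lemma automorphism_action_RP:
  fixes M :: "('m, 'n) monoid_scheme"
  assumes M: "topological_comm_group M TM"
  shows "automorphism_action (M \<times>\<times> RP) (prod_topology TM TRP) (apsnd ` elementary_maps)"
proof -
  interpret MR: topological_comm_group "M \<times>\<times> RP" "prod_topology TM TRP"
    by (intro topological_comm_group_DirProd M topological_comm_group_RP)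
  show ?thesis
  proof
    show "countable (apsnd ` elementary_maps :: ('m \<times> (nat \<Rightarrow> 'a) \<Rightarrow> _) set)"
      using countable_elementary_maps by simp
    show "id \<in> (apsnd ` elementary_maps :: ('m \<times> (nat \<Rightarrow> 'a) \<Rightarrow> _) set)"
      unfolding elementary_maps_def by (rule image_eqI[OF _ compositions.id]) auto
    show "p \<circ> q \<in> apsnd ` elementary_maps"
      if pq: "p \<in> apsnd ` elementary_maps" "q \<in> apsnd ` elementary_maps" for p q :: "'m \<times> (nat \<Rightarrow> 'a) \<Rightarrow> _"
    proof -
      obtain p' q' where "p' \<in> elementary_maps" "q' \<in> elementary_maps" "p = apsnd p'" "q = apsnd q'"
        using pq by blast
      moreover from this have "p \<circ> q = apsnd (p' \<circ> q')" by (simp add: fun_eq_iff)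
      ultimately show ?thesis using elementary_maps_comp by blast
    qed
    show "\<exists>q'\<in>apsnd ` elementary_maps. q \<circ> q' = id \<and> q' \<circ> q = id"
      if q: "q \<in> apsnd ` elementary_maps" for q :: "'m \<times> (nat \<Rightarrow> 'a) \<Rightarrow> _"
    proof -
      obtain p where p: "p \<in> elementary_maps" "q = apsnd p" using q by blast
      obtain p' where p': "p' \<in> elementary_maps" "p \<circ> p' = id" "p' \<circ> p = id"
        using elementary_maps_inverse[OF p(1)] by blast
      have "p (p' x) = x" "p' (p x) = x" for x using p'(2,3) by (simp_all add: fun_eq_iff)
      then have "q \<circ> apsnd p' = id" "apsnd p' \<circ> q = id" unfolding p(2) by (simp_all add: fun_eq_iff)
      with p'(1) show ?thesis by blast
    qed
    show "q \<in> hom (M \<times>\<times> RP) (M \<times>\<times> RP)" if "q \<in> apsnd ` elementary_maps" for q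
      using that elementary_maps_hom_continuous(1) hom_DirProd_apsnd by blast
    show "continuous_map (prod_topology TM TRP) (prod_topology TM TRP) q"
      if q: "q \<in> apsnd ` elementary_maps" for q
    proof -
      obtain p where p: "p \<in> elementary_maps" "q = apsnd p" using q by blast
      have "continuous_map (prod_topology TM TRP) (prod_topology TM TRP) (\<lambda>z. (fst z, p (snd z)))"
        by (rule continuous_map_pairedI[OF continuous_map_fst continuous_map_compose[unfolded comp_def,
              OF continuous_map_snd elementary_maps_hom_continuous(2)[OF p(1)]]])
      moreover have "q = (\<lambda>z. (fst z, p (snd z)))" unfolding p(2) by auto
      ultimately show ?thesis by simp
    qed
  qed
qed

text \<open>Supplies the hypothesis \<open>small\<close> of \<open>duoseparable_E\<close>. A
  translation from \<open>SM\<close> settles the first component; the second is translated into the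
  power of \<open>C\<close> and then shrunk by an elementary map, which does not disturb the
  first.\<close>

lemma small_translate_RP:
  assumes M: "topological_comm_group M TM"
    and SM: "countable SM" "SM \<subseteq> carrier M"
      "\<And>U m. \<lbrakk>openin TM U; \<one>\<^bsub>M\<^esub> \<in> U; m \<in> carrier M\<rbrakk> \<Longrightarrow> \<exists>s\<in>SM. m \<otimes>\<^bsub>M\<^esub> s \<in> U"
    and SA: "countable SA" "SA \<subseteq> carrier A" "\<And>a. a \<in> carrier A \<Longrightarrow> \<exists>s\<in>SA. a \<otimes> s \<in> C"
  obtains S where "countable S" "S \<subseteq> carrier (M \<times>\<times> RP)"
    "\<And>U h. \<lbrakk>openin (prod_topology TM TRP) U; \<one>\<^bsub>M \<times>\<times> RP\<^esub> \<in> U; h \<in> carrier (M \<times>\<times> RP)\<rbrakk>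
      \<Longrightarrow> \<exists>s\<in>S. \<exists>q\<in>apsnd ` elementary_maps. q (h \<otimes>\<^bsub>M \<times>\<times> RP\<^esub> s) \<in> U"
proof -
  obtain R where R: "countable R" "R \<subseteq> carrier RP"
    "\<And>x. x \<in> carrier RP \<Longrightarrow> \<exists>y\<in>R. \<forall>i. (x \<otimes>\<^bsub>RP\<^esub> y) i \<in> C"
    using coset_representatives_RP[OF SA] by metis
  show ?thesis
  proof
    show "countable (SM \<times> R)" using SM(1) R(1) by simp
    show "SM \<times> R \<subseteq> carrier (M \<times>\<times> RP)" using SM(2) R(2) by auto
    fix U h assume U: "openin (prod_topology TM TRP) U" "\<one>\<^bsub>M \<times>\<times> RP\<^esub> \<in> U" and "h \<in> carrier (M \<times>\<times> RP)"
    then obtain m x where h: "h = (m, x)" "m \<in> carrier M" "x \<in> carrier RP" by auto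
    have "(\<one>\<^bsub>M\<^esub>, \<one>\<^bsub>RP\<^esub>) \<in> U" using U(2) by simp
    then obtain U1 U2 where U12: "openin TM U1" "openin TRP U2" "\<one>\<^bsub>M\<^esub> \<in> U1" "\<one>\<^bsub>RP\<^esub> \<in> U2" "U1 \<times> U2 \<subseteq> U"
      by (rule openin_prod_topologyE[OF U(1)])
    obtain s where s: "s \<in> SM" "m \<otimes>\<^bsub>M\<^esub> s \<in> U1" using SM(3)[OF U12(1,3) h(2)] by blast
    obtain y where y: "y \<in> R" "\<And>i. (x \<otimes>\<^bsub>RP\<^esub> y) i \<in> C" using R(3)[OF h(3)] by blast
    obtain F V where F: "finite F" "openin T V" "\<one> \<in> V"
      "\<And>x. (\<forall>i. x i \<in> C) \<Longrightarrow> (\<forall>i\<in>F. x i \<in> V) \<Longrightarrow> x \<in> U2"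
      using unit_neighborhood_RP[OF U12(2,4)] by metis
    obtain q where q: "q \<in> elementary_maps" "\<forall>i. q (x \<otimes>\<^bsub>RP\<^esub> y) i \<in> C" "\<forall>f\<in>F. q (x \<otimes>\<^bsub>RP\<^esub> y) f \<in> V"
      using elementary_map_small[where x = "x \<otimes>\<^bsub>RP\<^esub> y", OF F(2,3) y(2) F(1)] by blast
    have "apsnd q (h \<otimes>\<^bsub>M \<times>\<times> RP\<^esub> (s, y)) \<in> U1 \<times> U2"
      using s(2) F(4)[OF q(2,3)] by (simp add: h(1))
    then have "apsnd q (h \<otimes>\<^bsub>M \<times>\<times> RP\<^esub> (s, y)) \<in> U" using U12(5) by (rule rev_subsetD)
    then show "\<exists>s\<in>SM \<times> R. \<exists>q\<in>apsnd ` elementary_maps. q (h \<otimes>\<^bsub>M \<times>\<times> RP\<^esub> s) \<in> U"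
      using q(1) s(1) y(1) by (intro bexI[of _ "(s, y)"] bexI[of _ "apsnd q"]) auto
  qed
qed

end

section \<open>Transport of topological groups and their properties along bijections\<close>

lemma topological_group_transport:
  fixes \<phi> :: "'a \<Rightarrow> 'c"
  assumes "topological_group E T" "inj_on \<phi> (carrier E)"
  obtains E' :: "'c monoid" and T' :: "'c topology"
  where "topological_group E' T'" "\<phi> \<in> iso E E'" "homeomorphic_map T T' \<phi>"
proof -
  interpret E: topological_group E T by fact
  define \<psi> where "\<psi> = inv_into (carrier E) \<phi>"
  have \<psi>\<phi>: "\<psi> (\<phi> x) = x" if "x \<in> carrier E" for x using assms(2) that by (simp add: \<psi>_def)
  define E' :: "'c monoid" where "E' = \<lparr>carrier = \<phi> ` carrier E, mult = \<lambda>u v. \<phi> (\<psi> u \<otimes>\<^bsub>E\<^esub> \<psi> v), one = \<phi> \<one>\<^bsub>E\<^esub>\<rparr>"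
  define T' where "T' = pullback_topology (\<phi> ` carrier E) \<psi> T"
  have E': "carrier E' = \<phi> ` carrier E" "\<And>u v. u \<otimes>\<^bsub>E'\<^esub> v = \<phi> (\<psi> u \<otimes>\<^bsub>E\<^esub> \<psi> v)" "\<one>\<^bsub>E'\<^esub> = \<phi> \<one>\<^bsub>E\<^esub>"
    by (simp_all add: E'_def)
  have "group E'"
  proof (rule groupI)
    show "\<exists>y\<in>carrier E'. y \<otimes>\<^bsub>E'\<^esub> x = \<one>\<^bsub>E'\<^esub>" if x: "x \<in> carrier E'" for x
    proof -
      obtain g where "g \<in> carrier E" "x = \<phi> g" using x E'(1) by auto
      then show ?thesis by (intro bexI[of _ "\<phi> (inv\<^bsub>E\<^esub> g)"]) (auto simp: E' \<psi>\<phi>)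
    qed
  qed (auto simp: E' \<psi>\<phi> E.m_assoc)
  then interpret E': group E' .
  have iso: "\<phi> \<in> iso E E'"
    using assms(2) by (auto simp: iso_def hom_def bij_betw_def E' \<psi>\<phi>)
  have inv: "inv\<^bsub>E'\<^esub> (\<phi> g) = \<phi> (inv\<^bsub>E\<^esub> g)" if "g \<in> carrier E" for g
    by (rule E'.inv_equality) (use that in \<open>auto simp: E' \<psi>\<phi>\<close>)
  have top: "topspace T' = carrier E'"
    by (auto simp: T'_def topspace_pullback_topology E' E.topspace_eq_carrier \<psi>\<phi>)
  have \<phi>: "continuous_map T T' \<phi>"
    unfolding T'_def
  proof (rule continuous_map_pullback')
    show "continuous_map T T (\<psi> \<circ> \<phi>)"
      by (rule continuous_map_eq[OF continuous_map_id]) (simp add: E.topspace_eq_carrier \<psi>\<phi>)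
  qed (auto simp: E.topspace_eq_carrier)
  have \<psi>: "continuous_map T' T \<psi>"
    using continuous_map_pullback[of T T "\<lambda>x. x" "\<phi> ` carrier E" \<psi>] by (simp add: T'_def o_def)
  have "homeomorphic_maps T T' \<phi> \<psi>"
    unfolding homeomorphic_maps_def using \<phi> \<psi> by (auto simp: top E.topspace_eq_carrier E' \<psi>\<phi>)
  then have homeo: "homeomorphic_map T T' \<phi>" using homeomorphic_maps_map by blast
  have c: "continuous_map X T' (\<lambda>x. \<phi> (f x))" if "continuous_map X T f" for X :: "'x topology" and f
    using continuous_map_compose[OF that \<phi>] by (simp add: o_def)
  have "continuous_map (prod_topology T' T') T' (\<lambda>z. \<phi> (\<psi> (fst z) \<otimes>\<^bsub>E\<^esub> \<psi> (snd z)))"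
    by (rule c[OF E.continuous_map_mult[OF
            continuous_map_compose[unfolded comp_def, OF continuous_map_fst \<psi>]
            continuous_map_compose[unfolded comp_def, OF continuous_map_snd \<psi>]]])
  moreover have "continuous_map T' T' (\<lambda>x. \<phi> (inv\<^bsub>E\<^esub> \<psi> x))"
    by (rule c[OF E.continuous_map_m_inv[OF \<psi>]])
  then have "continuous_map T' T' (\<lambda>x. inv\<^bsub>E'\<^esub> x)"
    by (rule continuous_map_eq) (auto simp: top E' inv \<psi>\<phi>)
  ultimately have "topological_group E' T'"
    by unfold_locales (simp_all add: top E'(2) case_prod_unfold)
  then show ?thesis using that iso homeo by blast
qed

lemma duoseparable_iso:
  assumes E: "topological_group E T" and E': "topological_group E' T'"
    and iso: "\<phi> \<in> iso E E'" and homeo: "homeomorphic_map T T' \<phi>" and "duoseparable E T"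
  shows "duoseparable E' T'"
proof -
  interpret E: topological_group E T by fact
  interpret E': topological_group E' T' by fact
  have hom: "\<phi> \<in> hom E E'" and im: "\<phi> ` carrier E = carrier E'"
    using iso by (auto simp: iso_def bij_betw_def)
  obtain S where S: "S \<subseteq> carrier E" "countable S"
    "\<forall>U. unit_neighborhood E T U \<longrightarrow> carrier E = S <#>\<^bsub>E\<^esub> U <#>\<^bsub>E\<^esub> S"
    using assms(5) unfolding duoseparable_def by (elim exE conjE)
  have "carrier E' = \<phi> ` S <#>\<^bsub>E'\<^esub> U <#>\<^bsub>E'\<^esub> \<phi> ` S" if U: "unit_neighborhood E' T' U" for U
  proof -
    let ?U = "{x \<in> carrier E. \<phi> x \<in> U}"
    obtain V where V: "openin T' V" "\<one>\<^bsub>E'\<^esub> \<in> V" "V \<subseteq> U" and Uc: "U \<subseteq> carrier E'"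
      using U unfolding unit_neighborhood_def by blast
    have "openin T {x \<in> topspace T. \<phi> x \<in> V}"
      using homeo V(1) by (intro openin_continuous_map_preimage homeomorphic_imp_continuous_map)
    moreover have "\<one>\<^bsub>E\<^esub> \<in> {x \<in> topspace T. \<phi> x \<in> V}"
      using V(2) hom_one[OF hom E.is_group E'.is_group] by (simp add: E.topspace_eq_carrier)
    ultimately have "unit_neighborhood E T ?U"
      unfolding unit_neighborhood_def using V(3)
      by (intro conjI exI[of _ "{x \<in> topspace T. \<phi> x \<in> V}"]) (auto simp: E.topspace_eq_carrier)
    then have eq: "carrier E = S <#>\<^bsub>E\<^esub> ?U <#>\<^bsub>E\<^esub> S" by (rule S(3)[rule_format])
    have "\<phi> ` ?U = U"
    proof
      show "U \<subseteq> \<phi> ` ?U"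
      proof
        fix u assume u: "u \<in> U"
        then have "u \<in> \<phi> ` carrier E" using Uc im by blast
        then obtain x where "x \<in> carrier E" "u = \<phi> x" by (rule imageE)
        with u show "u \<in> \<phi> ` ?U" by simp
      qed
    qed auto
    have "carrier E' = \<phi> ` (S <#>\<^bsub>E\<^esub> ?U <#>\<^bsub>E\<^esub> S)" using eq im by simp
    also have "\<dots> = \<phi> ` S <#>\<^bsub>E'\<^esub> \<phi> ` ?U <#>\<^bsub>E'\<^esub> \<phi> ` S"
      using S(1) by (simp add: set_mult_hom[OF hom] E.set_mult_closed)
    finally show ?thesis using \<open>\<phi> ` ?U = U\<close> by simp
  qed
  moreover have "\<phi> ` S \<subseteq> carrier E'" "countable (\<phi> ` S)" using S(1,2) im by auto
  ultimately show ?thesis unfolding duoseparable_def by (intro exI[of _ "\<phi> ` S"] conjI allI impI)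
qed

lemma abelian_by_countable_iso:
  assumes E: "topological_group E T" and E': "topological_group E' T'"
    and iso: "\<phi> \<in> iso E E'" and homeo: "homeomorphic_map T T' \<phi>" and "abelian_by_countable E T"
  shows "abelian_by_countable E' T'"
proof -
  interpret E: topological_group E T by fact
  interpret E': topological_group E' T' by fact
  have hom: "\<phi> \<in> hom E E'" and im: "\<phi> ` carrier E = carrier E'"
    using iso by (auto simp: iso_def bij_betw_def)
  obtain H where H: "closedin T H" "H \<lhd> E" "comm_group (E\<lparr>carrier := H\<rparr>)" "countable (carrier (E Mod H))"
    using assms(5) unfolding abelian_by_countable_def by (elim exE conjE)
  have Hc: "H \<subseteq> carrier E" using closedin_subset[OF H(1)] by (simp add: E.topspace_eq_carrier)
  have normal: "\<phi> ` H \<lhd> E'"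
    using iso_normal_subgroup[OF iso E.is_group E'.is_group H(2)] .
  have "closedin T' (\<phi> ` H)"
    using homeomorphic_map_closedness[OF homeo, of H] Hc H(1) by (simp add: E.topspace_eq_carrier)
  moreover have "comm_group (E'\<lparr>carrier := \<phi> ` H\<rparr>)"
  proof (rule group.group_comm_groupI)
    show "group (E'\<lparr>carrier := \<phi> ` H\<rparr>)"
      by (rule E'.subgroup_imp_group[OF normal_imp_subgroup[OF normal]])
    fix x y assume "x \<in> carrier (E'\<lparr>carrier := \<phi> ` H\<rparr>)" "y \<in> carrier (E'\<lparr>carrier := \<phi> ` H\<rparr>)"
    then obtain g h where "g \<in> H" "h \<in> H" "x = \<phi> g" "y = \<phi> h" by auto
    moreover from this have "g \<otimes>\<^bsub>E\<^esub> h = h \<otimes>\<^bsub>E\<^esub> g"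
      using comm_monoid.m_comm[OF comm_group.axioms(1)[OF H(3)]] by simp
    ultimately show "x \<otimes>\<^bsub>E'\<lparr>carrier := \<phi> ` H\<rparr>\<^esub> y = y \<otimes>\<^bsub>E'\<lparr>carrier := \<phi> ` H\<rparr>\<^esub> x"
      using Hc by (simp add: hom_mult[OF hom, symmetric] subset_iff)
  qed
  moreover have "\<phi> ` (H #>\<^bsub>E\<^esub> x) = \<phi> ` H #>\<^bsub>E'\<^esub> \<phi> x" if "x \<in> carrier E" for x
    using that Hc by (auto simp: r_coset_def image_UN hom_mult[OF hom] subset_iff)
  then have "carrier (E' Mod \<phi> ` H) \<subseteq> image \<phi> ` carrier (E Mod H)"
    unfolding carrier_FactGroup im[symmetric] by (auto simp: image_image)
  then have "countable (carrier (E' Mod \<phi> ` H))" by (rule countable_subset) (simp add: H(4))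
  ultimately show ?thesis
    unfolding abelian_by_countable_def by (intro exI[of _ "\<phi> ` H"] conjI normal)
qed

section \<open>The embedding\<close>

text \<open>The hypothesis \<open>small\<close> is continuity at the unit of the inverse on the
  image; left translation spreads it to every point.\<close>

lemma embedding_of_topological_groups:
  assumes G: "topological_group G T" and E: "topological_group E T'"
    and hom: "f \<in> hom G E" and inj: "inj_on f (carrier G)" and cont: "continuous_map T T' f"
    and small: "\<And>V. \<lbrakk>openin T V; \<one>\<^bsub>G\<^esub> \<in> V\<rbrakk> \<Longrightarrow>
      \<exists>N. openin T' N \<and> \<one>\<^bsub>E\<^esub> \<in> N \<and> (\<forall>h\<in>carrier G. f h \<in> N \<longrightarrow> h \<in> V)"
  shows "homeomorphic_map T (subtopology T' (f ` carrier G)) f"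
proof (rule bijective_open_imp_homeomorphic_map)
  interpret G: topological_group G T by fact
  interpret E: topological_group E T' by fact
  have fc: "f g \<in> carrier E" if "g \<in> carrier G" for g using hom that by (rule hom_in_carrier)
  show "continuous_map T (subtopology T' (f ` carrier G)) f"
    using cont by (auto simp: continuous_map_in_subtopology G.topspace_eq_carrier)
  show "f ` topspace T = topspace (subtopology T' (f ` carrier G))"
    using fc by (auto simp: G.topspace_eq_carrier E.topspace_eq_carrier)
  show "inj_on f (topspace T)" using inj by (simp add: G.topspace_eq_carrier)
  show "open_map T (subtopology T' (f ` carrier G)) f"
    unfolding open_map_def
  proof (intro allI impI)
    fix V assume V: "openin T V"
    have Vc: "V \<subseteq> carrier G" using V by (rule G.openin_subset_carrier)
    have nb: "\<exists>W. openin (subtopology T' (f ` carrier G)) W \<and> f g \<in> W \<and> W \<subseteq> f ` V" if g: "g \<in> V" for g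
    proof -
      have gc: "g \<in> carrier G" using g Vc by blast
      define V0 where "V0 = {x \<in> carrier G. g \<otimes>\<^bsub>G\<^esub> x \<in> V}"
      have "openin T V0" unfolding V0_def by (rule G.openin_preimage_l_mult[OF V gc])
      moreover have "\<one>\<^bsub>G\<^esub> \<in> V0" using g gc by (simp add: V0_def)
      ultimately obtain N where N: "openin T' N" "\<one>\<^bsub>E\<^esub> \<in> N" "\<And>h. \<lbrakk>h \<in> carrier G; f h \<in> N\<rbrakk> \<Longrightarrow> h \<in> V0"
        using small by metis
      define Z where "Z = {z \<in> carrier E. f (inv\<^bsub>G\<^esub> g) \<otimes>\<^bsub>E\<^esub> z \<in> N}"
      have Z: "openin T' Z" unfolding Z_def using gc by (intro E.openin_preimage_l_mult N(1) fc) simp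
      have mult: "f (inv\<^bsub>G\<^esub> g) \<otimes>\<^bsub>E\<^esub> f h = f (inv\<^bsub>G\<^esub> g \<otimes>\<^bsub>G\<^esub> h)" if "h \<in> carrier G" for h
        using hom_mult[OF hom] gc that by simp
      have "f g \<in> Z"
        unfolding Z_def using gc fc N(2) mult[OF gc] hom_one[OF hom G.is_group E.is_group] by simp
      moreover have "Z \<inter> f ` carrier G \<subseteq> f ` V"
      proof
        fix z assume "z \<in> Z \<inter> f ` carrier G"
        then obtain h where h: "h \<in> carrier G" "z = f h" "f (inv\<^bsub>G\<^esub> g) \<otimes>\<^bsub>E\<^esub> f h \<in> N" by (auto simp: Z_def)
        then have "inv\<^bsub>G\<^esub> g \<otimes>\<^bsub>G\<^esub> h \<in> V0" using gc mult by (intro N(3)) auto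
        then have "h \<in> V" using gc h(1) by (simp add: V0_def G.m_assoc[symmetric])
        then show "z \<in> f ` V" using h(2) by blast
      qed
      moreover have "openin (subtopology T' (f ` carrier G)) (Z \<inter> f ` carrier G)"
        using Z by (auto simp: openin_subtopology)
      ultimately show ?thesis using gc by (intro exI[of _ "Z \<inter> f ` carrier G"]) auto
    qed
    show "openin (subtopology T' (f ` carrier G)) (f ` V)"
    proof (subst openin_subopen, rule ballI)
      fix y assume "y \<in> f ` V"
      then obtain g where "g \<in> V" "y = f g" by blast
      then show "\<exists>W. openin (subtopology T' (f ` carrier G)) W \<and> y \<in> W \<and> W \<subseteq> f ` V" using nb by blast
    qed
  qed
qed

text \<open>A point off \<open>D\<close> has a neighborhood inside a compact set, from which only
  finitely many points of \<open>D\<close> have to be removed. Applied to the discrete subgroup, it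
  makes the quotient by \<open>D\<close> Hausdorff when \<open>G\<close> is.\<close>

lemma locally_finite_imp_closedin:
  assumes "Hausdorff_space T" "locally_compact_space T" "D \<subseteq> topspace T"
    "\<And>L. compactin T L \<Longrightarrow> finite (L \<inter> D)"
  shows "closedin T D"
  unfolding closedin_def
proof (intro conjI assms(3), subst openin_subopen, rule ballI)
  fix p assume p: "p \<in> topspace T - D"
  then obtain U P where UP: "openin T U" "compactin T P" "p \<in> U" "U \<subseteq> P"
    using assms(2) unfolding locally_compact_space_def by blast
  have fin: "finite (P \<inter> D)" by (rule assms(4)[OF UP(2)])
  have "closedin T (P \<inter> D)"
    using fin assms(3) by (intro closedin_Hausdorff_finite[OF assms(1)]) auto
  then have "openin T (U - P \<inter> D)" using UP(1) by (rule openin_diff[rotated])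
  moreover have "p \<in> U - P \<inter> D" "U - P \<inter> D \<subseteq> topspace T - D"
    using p UP openin_subset by fastforce+
  ultimately show "\<exists>W. openin T W \<and> p \<in> W \<and> W \<subseteq> topspace T - D" by blast
qed

lemma (in topological_group) open_subgroup_closedin:
  assumes "subgroup N G" "openin T N"
  shows "closedin T N"
proof -
  have Nc: "N \<subseteq> carrier G" by (rule subgroup.subset[OF assms(1)])
  have "(carrier G - N) <#> N = carrier G - N"
  proof (intro equalityI subsetI)
    fix x assume "x \<in> (carrier G - N) <#> N"
    then obtain a n where x: "a \<in> carrier G" "a \<notin> N" "n \<in> N" "x = a \<otimes> n" by (auto elim!: set_multE)
    have nc: "n \<in> carrier G" using x(3) Nc by blast
    have "a \<in> N" if "x \<in> N"
    proof -
      have "a = x \<otimes> inv n" using x nc by (simp add: m_assoc)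
      then show ?thesis using that x(3) assms(1) subgroup.m_closed subgroup.m_inv_closed by metis
    qed
    then show "x \<in> carrier G - N" using x nc by auto
  next
    fix x assume x: "x \<in> carrier G - N"
    then have "x \<otimes> \<one> \<in> (carrier G - N) <#> N"
      by (intro set_multI) (auto simp: subgroup.one_closed[OF assms(1)])
    then show "x \<in> (carrier G - N) <#> N" using x by simp
  qed
  moreover have "openin T ((carrier G - N) <#> N)" by (rule openin_set_mult_right[OF assms(2)]) auto
  ultimately show ?thesis using Nc by (simp add: closedin_def topspace_eq_carrier)
qed

lemma (in compact_open_subgroup) continuous_map_single_coordinate:
  "continuous_map T TRP (\<lambda>a i. if i = 0 then a else \<one>)"
proof (rule continuous_map_into_RP)
  show "(\<lambda>i. if i = 0 then a else \<one>) \<in> carrier RP" if "a \<in> topspace T" for a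
  proof -
    have "{i::nat. (if i = 0 then a else \<one>) \<notin> C} \<subseteq> {0}"
      using subgroup.one_closed[OF subgroup_C] by auto
    then have "finite {i::nat. (if i = 0 then a else \<one>) \<notin> C}" by (rule finite_subset) simp
    then show ?thesis using that by (simp add: carrier_RP topspace_eq_carrier)
  qed
  show "continuous_map T T (\<lambda>x. if k = 0 then x else \<one>)" for k :: nat
    by (simp add: topspace_eq_carrier)
  \<comment> \<open>Since \<open>C\<close> is open, every union of its cosets is open, so the coset
    map is continuous even into a discrete space.\<close>
  have coset: "continuous_map T (discrete_topology UNIV) (\<lambda>a. C #> a)"
    unfolding continuous_map
  proof (intro conjI allI impI)
    fix B :: "'a set set"
    let ?Z = "{a \<in> topspace T. C #> a \<in> B}"
    have "?Z <#> C = ?Z"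
    proof (intro equalityI subsetI)
      fix x assume "x \<in> ?Z <#> C"
      then obtain a c where x: "a \<in> carrier A" "C #> a \<in> B" "c \<in> C" "x = c \<otimes> a"
        using C_subset by (auto elim!: set_multE simp: topspace_eq_carrier m_comm subset_iff)
      then have "C #> x = C #> a"
        using repr_independence[OF _ _ subgroup_C, of x a] C_subset by (auto simp: r_coset_def)
      with x show "x \<in> ?Z" using C_subset by (auto simp: topspace_eq_carrier)
    next
      fix x assume x: "x \<in> ?Z"
      then have "x \<otimes> \<one> \<in> ?Z <#> C" by (intro set_multI) (auto simp: subgroup.one_closed[OF subgroup_C])
      then show "x \<in> ?Z <#> C" using x by (simp add: topspace_eq_carrier)
    qed
    moreover have "openin T (?Z <#> C)"
      by (rule openin_set_mult_right[OF openin_C]) (auto simp: topspace_eq_carrier)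
    ultimately show "openin T ?Z" by simp
  qed simp
  have "continuous_map T (discrete_topology UNIV) (\<lambda>a i::nat. if i = 0 then C #> a else C)"
    by (rule continuous_map_discrete_combine[where h = "\<lambda>b b' i. if i = 0 then b else C", OF coset coset])
  then show "continuous_map T (discrete_topology UNIV) (\<lambda>a i::nat. C #> (if i = 0 then a else \<one>))"
    by (rule continuous_map_eq) (auto simp: fun_eq_iff coset_C subgroup.one_closed[OF subgroup_C])
qed

text \<open>The even tags number the sets \<open>y n\<close>; the odd tag records \<open>k\<close>.\<close>

definition encode :: "(nat \<Rightarrow> 'a set) \<Rightarrow> nat \<Rightarrow> 'a points" where
  "encode y k = insert {Inr (2 * k + 1)} (range (\<lambda>n. insert (Inr (2 * n)) (Inl ` y n)))"

lemma encode_inject: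
  assumes "encode y k = encode z l"
  shows "y = z" "k = l"
proof -
  \<comment> \<open>The tag \<open>Inr (2 * n)\<close> occurs in exactly one member of the code,
    which allows \<open>w n\<close> to be read off even when it is empty.\<close>
  have y: "w n = {a. \<exists>Z\<in>encode w m. Inr (2 * n) \<in> Z \<and> Inl a \<in> Z}" for w :: "nat \<Rightarrow> 'a set" and m n
    unfolding encode_def by auto
  show "y = z" using y[of y _ k] y[of z _ l] assms by (simp add: fun_eq_iff)
  have k: "Inr (2 * j + 1) \<in> \<Union>(encode w m) \<longleftrightarrow> j = m" for w :: "nat \<Rightarrow> 'a set" and m j
    unfolding encode_def by (auto, presburger)
  show "k = l" using k[of k y k] k[of k z l] assms by simp
qed

text \<open>The group is built on its natural type of cosets, sequences of cosets and automorphisms.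
  Countability of the second components is exported so that the automorphisms can later be
  numbered.\<close>

lemma (in topological_comm_group) embedding_into_semidirect:
  assumes lc: "locally_compact_space T" and sigma: "sigma_compact_space T"
  obtains E :: "(('a set \<times> (nat \<Rightarrow> 'a set)) \<times> ('a set \<times> (nat \<Rightarrow> 'a set) \<Rightarrow> 'a set \<times> (nat \<Rightarrow> 'a set))) monoid"
    and TE f
  where "topological_group E TE" "locally_compact_space TE" "Hausdorff_space T \<Longrightarrow> Hausdorff_space TE"
    "duoseparable E TE" "abelian_by_countable E TE" "countable (snd ` carrier E)"
    "f \<in> hom G E" "inj_on f (carrier G)" "homeomorphic_map T (subtopology TE (f ` carrier G)) f"
proof -
  obtain K S where K: "subgroup K G" "compactin T K" "closedin T K" and S: "countable S" "S \<subseteq> carrier G"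
    "\<And>V. \<lbrakk>openin T V; \<one> \<in> V\<rbrakk> \<Longrightarrow> carrier G \<subseteq> S <#> (K <#> V)"
    by (rule compact_subgroup_separable_quotient[OF lc sigma]) blast
  obtain G0 D C0 where G0: "subgroup G0 G" "openin T G0" and D: "subgroup D G" "D \<subseteq> G0"
    and tf: "\<And>x n::int. \<lbrakk>x \<in> D; n \<noteq> 0; x [^] n = \<one>\<rbrakk> \<Longrightarrow> x = \<one>"
    and lf: "\<And>L. compactin T L \<Longrightarrow> finite (L \<inter> D)" and C0: "compactin T C0" "G0 \<subseteq> C0 <#> D"
    by (rule open_subgroup_cocompact_discrete[OF lc]) blast
  \<comment> \<open>As \<open>G0\<close> is open, countably many translates cover \<open>G\<close>,
    so \<open>C\<close> will have countable index in \<open>?A\<close>.\<close>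
  obtain S0 where S0: "countable S0" "S0 \<subseteq> carrier G" "carrier G \<subseteq> S0 <#> G0"
    by (rule sigma_compact_countable_translates[OF sigma G0(2) subgroup.one_closed[OF G0(1)]])
  have Kc: "K \<subseteq> carrier G" and Dc: "D \<subseteq> carrier G" and G0c: "G0 \<subseteq> carrier G" and C0c: "C0 \<subseteq> carrier G"
    using subgroup.subset[OF K(1)] subgroup.subset[OF D(1)] subgroup.subset[OF G0(1)]
      compactin_subset_carrier[OF C0(1)] by auto
  have KD: "K \<inter> D = {\<one>}" by (rule compact_Int_torsion_free_discrete[OF K(1,2) D(1) tf lf])
  interpret QK: topological_group_quotient G T K
    by (intro topological_group_quotient.intro topological_group_axioms subgroup_imp_normal K)
  interpret QD: topological_group_quotient G T D
    by (intro topological_group_quotient.intro topological_group_axioms subgroup_imp_normal D)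
  let ?M = "G Mod K" and ?TM = "quotient_group_topology G T K"
  let ?A = "G Mod D" and ?TA = "quotient_group_topology G T D"
  define C where "C = (\<lambda>x. D #> x) ` G0"
  interpret M: topological_comm_group ?M ?TM
    by (intro topological_comm_group.intro QK.topological_group_quotient abelian_FactGroup K)
  interpret A: topological_comm_group ?A ?TA
    by (intro topological_comm_group.intro QD.topological_group_quotient abelian_FactGroup D)
  interpret A: compact_open_subgroup ?A ?TA C
  proof (rule compact_open_subgroup.intro[OF A.topological_comm_group_axioms compact_open_subgroup_axioms.intro])
    interpret h: group_hom G ?A "\<lambda>x. D #> x"
      by (intro group_hom.intro is_group A.is_group group_hom_axioms.intro QD.r_coset_hom_Mod)
    show "subgroup C ?A" unfolding C_def by (rule h.subgroup_img_is_subgroup[OF G0(1)])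
    show "openin ?TA C" unfolding C_def by (rule QD.openin_image_coset[OF G0(2)])
    \<comment> \<open>The set \<open>C0\<close> may leave \<open>G0\<close>; cutting it down keeps
      it compact, since an open subgroup is closed. Nothing is lost modulo \<open>D\<close>: if
      \<open>c \<otimes> \<delta>\<close> is in \<open>G0\<close>, so is \<open>c\<close>, because
      \<open>D \<subseteq> G0\<close>.\<close>
    have "compactin T (C0 \<inter> G0)"
      by (rule compact_Int_closedin[OF C0(1) open_subgroup_closedin[OF G0]])
    then have "compactin ?TA ((\<lambda>x. D #> x) ` (C0 \<inter> G0))"
      by (rule image_compactin[OF _ QD.continuous_map_coset])
    moreover have "C \<subseteq> (\<lambda>x. D #> x) ` (C0 \<inter> G0)"
      unfolding C_def
    proof (rule image_subsetI)
      fix x assume x: "x \<in> G0"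
      then obtain c \<delta> where c: "c \<in> C0" "\<delta> \<in> D" "x = c \<otimes> \<delta>" using C0(2) by (auto elim!: set_multE)
      have cc: "c \<in> carrier G" "\<delta> \<in> carrier G" using c C0c Dc by auto
      then have "c = x \<otimes> inv \<delta>" using c(3) by (simp add: m_assoc)
      then have "c \<in> G0" using x c(2) D(2) G0(1) subgroup.m_closed subgroup.m_inv_closed subsetD by metis
      moreover have "D #> x = D #> c" using c cc x G0c by (subst QD.coset_eq_iff) (auto simp: m_comm)
      ultimately show "D #> x \<in> (\<lambda>x. D #> x) ` (C0 \<inter> G0)" using c(1) by blast
    qed
    then have "C = (\<lambda>x. D #> x) ` (C0 \<inter> G0)" unfolding C_def by blast
    ultimately show "compactin ?TA C" by simp
  qed
  \<comment> \<open>Inverses appear because the covering gives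
    \<open>g = s \<otimes> (k \<otimes> v)\<close>, so it is \<open>inv s\<close> that moves
    \<open>g\<close> into the coset of \<open>v\<close>.\<close>
  have SM: "\<exists>s\<in>(\<lambda>s. K #> inv s) ` S. m \<otimes>\<^bsub>?M\<^esub> s \<in> U"
    if U: "openin ?TM U" "\<one>\<^bsub>?M\<^esub> \<in> U" and m: "m \<in> carrier ?M" for U m
  proof -
    obtain g where g: "g \<in> carrier G" "m = K #> g" using m by (auto simp: carrier_FactGroup)
    let ?V = "{x \<in> carrier G. K #> x \<in> U}"
    have "openin T ?V" using U(1) by (simp add: QK.openin_quotient)
    moreover have "\<one> \<in> ?V" using U(2) Kc by simp
    ultimately have "g \<in> S <#> (K <#> ?V)" by (rule subsetD[OF S(3)]) (rule g(1))
    then obtain s k v where s: "s \<in> S" "k \<in> K" "v \<in> carrier G" "K #> v \<in> U" "g = s \<otimes> (k \<otimes> v)"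
      by (auto elim!: set_multE)
    have c: "s \<in> carrier G" "k \<in> carrier G" using s S(2) Kc by auto
    have "g \<otimes> inv s = k \<otimes> v" unfolding s(5) using c s(3) by (simp add: m_comm[of s] m_assoc)
    then have "K #> (g \<otimes> inv s) = K #> v" using s c g by (subst QK.coset_eq_iff) auto
    then have "m \<otimes>\<^bsub>?M\<^esub> (K #> inv s) \<in> U" using s(4) g c by (simp add: QK.rcos_sum)
    then show ?thesis using s(1) by blast
  qed
  have SA: "\<exists>s\<in>(\<lambda>s. D #> inv s) ` S0. a \<otimes>\<^bsub>?A\<^esub> s \<in> C" if a: "a \<in> carrier ?A" for a
  proof -
    obtain g where g: "g \<in> carrier G" "a = D #> g" using a by (auto simp: carrier_FactGroup)
    then obtain s x where s: "s \<in> S0" "x \<in> G0" "g = s \<otimes> x" using S0(3) by (blast elim: set_multE)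
    have c: "s \<in> carrier G" "x \<in> carrier G" using s S0(2) G0c by auto
    have "g \<otimes> inv s = x" unfolding s(3) using c by (simp add: m_comm[of s] m_assoc)
    then have "a \<otimes>\<^bsub>?A\<^esub> (D #> inv s) = D #> x" using g c by (simp add: QD.rcos_sum)
    then show ?thesis using s(1,2) unfolding C_def by blast
  qed
  let ?R = "A.RP" and ?TR = "A.TRP"
  let ?Q = "apsnd ` A.elementary_maps :: ('a set \<times> (nat \<Rightarrow> 'a set) \<Rightarrow> _) set"
  let ?TH = "prod_topology ?TM ?TR"
  interpret H: automorphism_action "?M \<times>\<times> ?R" ?TH ?Q
    by (rule A.automorphism_action_RP) unfold_locales
  obtain SH where SH: "countable SH" "SH \<subseteq> carrier (?M \<times>\<times> ?R)"
    "\<And>U h. \<lbrakk>openin ?TH U; \<one>\<^bsub>?M \<times>\<times> ?R\<^esub> \<in> U; h \<in> carrier (?M \<times>\<times> ?R)\<rbrakk>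
      \<Longrightarrow> \<exists>s\<in>SH. \<exists>q\<in>?Q. q (h \<otimes>\<^bsub>?M \<times>\<times> ?R\<^esub> s) \<in> U"
  proof (rule A.small_translate_RP)
    show "topological_comm_group ?M ?TM" by unfold_locales
    show "countable ((\<lambda>s. K #> inv s) ` S)" "countable ((\<lambda>s. D #> inv s) ` S0)" using S(1) S0(1) by auto
    show "(\<lambda>s. K #> inv s) ` S \<subseteq> carrier ?M" "(\<lambda>s. D #> inv s) ` S0 \<subseteq> carrier ?A"
      using S(2) S0(2) by (auto simp: carrier_FactGroup)
    show "\<exists>s\<in>(\<lambda>s. K #> inv s) ` S. m \<otimes>\<^bsub>?M\<^esub> s \<in> U"
      if "openin ?TM U" "\<one>\<^bsub>?M\<^esub> \<in> U" "m \<in> carrier ?M" for U m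
      by (rule SM[OF that])
    show "\<exists>s\<in>(\<lambda>s. D #> inv s) ` S0. a \<otimes>\<^bsub>?A\<^esub> s \<in> C" if "a \<in> carrier ?A" for a
      by (rule SA[OF that])
  qed (rule that)
  have lcM: "locally_compact_space ?TM" by (rule QK.locally_compact_space_quotient[OF lc])
  have HM: "Hausdorff_space ?TM" by (rule QK.Hausdorff_space_quotient[OF K(3)])
  let ?y = "\<lambda>g i::nat. if i = 0 then D #> g else \<one>\<^bsub>?A\<^esub>"
  \<comment> \<open>The coset modulo \<open>D\<close> occupies coordinate 0; units elsewhere keep
    the sequence in the restricted power.\<close>
  define f where "f g = ((K #> g, ?y g), id :: 'a set \<times> (nat \<Rightarrow> 'a set) \<Rightarrow> _)" for g
  have contR: "continuous_map T ?TR ?y"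
    using continuous_map_compose[OF QD.continuous_map_coset A.continuous_map_single_coordinate]
    by (simp add: comp_def)
  have cont: "continuous_map T H.TE f"
    unfolding f_def
    by (rule continuous_map_pairedI[OF continuous_map_pairedI[OF QK.continuous_map_coset contR]])
       (simp add: H.id_Q)
  have "f g \<in> carrier H.E" if "g \<in> carrier G" for g
    using continuous_map_image_subset_topspace[OF cont] that
    unfolding H.topspace_E topspace_eq_carrier by blast
  moreover have "f (g \<otimes> h) = f g \<otimes>\<^bsub>H.E\<^esub> f h" if "g \<in> carrier G" "h \<in> carrier G" for g h
    using that A.r_one[OF A.one_closed]
    by (auto simp: f_def H.mult_E A.mult_RP fun_eq_iff QK.rcos_sum QD.rcos_sum)
  ultimately have hom: "f \<in> hom G H.E" by (intro homI)
  have coset_one: "K #> g = K \<longleftrightarrow> g \<in> K" "D #> g = D \<longleftrightarrow> g \<in> D" if "g \<in> carrier G" for g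
    using that K(1) D(1) coset_join1 coset_join2 by blast+
  interpret E: topological_group H.E H.TE by (rule H.topological_group_E)
  interpret f: group_hom G H.E f
    by (intro group_hom.intro is_group E.is_group group_hom_axioms.intro hom)
  have inj: "inj_on f (carrier G)"
  proof (rule f.inj_on_one_iff[THEN iffD2], intro allI impI)
    fix g assume g: "g \<in> carrier G" "f g = \<one>\<^bsub>H.E\<^esub>"
    then have "K #> g = K" "?y g = (\<lambda>i. D)" by (simp_all add: f_def H.one_E A.one_RP)
    moreover from fun_cong[OF this(2), of 0] have "D #> g = D" by simp
    ultimately have "g \<in> K \<inter> D" using coset_one[OF g(1)] by simp
    then show "g = \<one>" using KD by blast
  qed
  have homeo: "homeomorphic_map T (subtopology H.TE (f ` carrier G)) f"
  proof (rule embedding_of_topological_groups[OF topological_group_axioms H.topological_group_E hom inj cont])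
    fix V assume V: "openin T V" "\<one> \<in> V"
    obtain W where W: "openin T W" "\<one> \<in> W" "(W <#> K) \<inter> (W <#> D) \<subseteq> V"
      by (rule compact_discrete_separation[OF lc K D(1) KD lf V])
    have Wc: "W \<subseteq> carrier G" using W(1) by (rule openin_subset_carrier)
    \<comment> \<open>Restricting the \<open>?M\<close> component and coordinate 0 is enough:
      \<open>f h \<in> ?N\<close> puts \<open>h\<close> into both \<open>W <#> K\<close> and
      \<open>W <#> D\<close>.\<close>
    let ?N2 = "{y \<in> topspace ?TR. y 0 \<in> (\<lambda>x. D #> x) ` W}"
    let ?N = "((\<lambda>x. K #> x) ` W \<times> ?N2) \<times> ?Q"
    have "openin ?TR ?N2"
      by (rule openin_continuous_map_preimage[OF A.continuous_map_proj_RP QD.openin_image_coset[OF W(1)]])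
    then have "openin H.TE ?N"
      by (simp add: openin_prod_Times_iff QK.openin_image_coset[OF W(1)])
    moreover have "f \<one> \<in> ?N"
      using W(2) H.id_Q continuous_map_image_subset_topspace[OF contR]
      by (auto simp: f_def topspace_eq_carrier)
    then have "\<one>\<^bsub>H.E\<^esub> \<in> ?N" by simp
    moreover have "h \<in> V" if h: "h \<in> carrier G" "f h \<in> ?N" for h
    proof -
      obtain w w' where w: "w \<in> W" "K #> h = K #> w" "w' \<in> W" "D #> h = D #> w'"
        using h(2) by (auto simp: f_def)
      then obtain k \<delta> where k: "k \<in> K" "h = k \<otimes> w" "\<delta> \<in> D" "h = \<delta> \<otimes> w'"
        using h(1) Wc QK.coset_eq_iff[of h w] QD.coset_eq_iff[of h w'] by blast
      have c: "w \<in> carrier G" "w' \<in> carrier G" "k \<in> carrier G" "\<delta> \<in> carrier G" using w k Wc Kc Dc by auto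
      have "h = w \<otimes> k" "h = w' \<otimes> \<delta>" using k c m_comm by auto
      then have "h \<in> (W <#> K) \<inter> (W <#> D)" using w k by (metis IntI set_multI)
      then show ?thesis using W(3) by blast
    qed
    ultimately show "\<exists>N. openin H.TE N \<and> \<one>\<^bsub>H.E\<^esub> \<in> N \<and> (\<forall>h\<in>carrier G. f h \<in> N \<longrightarrow> h \<in> V)"
      by (intro exI[of _ ?N] conjI ballI impI)
  qed
  show ?thesis
  proof
    show "topological_group H.E H.TE" by (rule H.topological_group_E)
    show "locally_compact_space H.TE"
      by (rule H.locally_compact_E) (simp add: locally_compact_space_prod_topology lcM A.locally_compact_RP)
    show "Hausdorff_space H.TE" if "Hausdorff_space T"
    proof -
      have "closedin T D"
        by (rule locally_finite_imp_closedin[OF that lc _ lf]) (simp add: topspace_eq_carrier Dc)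
      then have "Hausdorff_space ?TA" by (rule QD.Hausdorff_space_quotient)
      then show ?thesis
        by (intro H.Hausdorff_E) (simp add: Hausdorff_space_prod_topology HM A.Hausdorff_RP)
    qed
    show "duoseparable H.E H.TE" by (rule H.duoseparable_E[OF SH])
    show "abelian_by_countable H.E H.TE" by (rule H.abelian_by_countable_E)
    show "countable (snd ` carrier H.E)"
      by (rule countable_subset[OF _ H.countable_Q]) (auto simp: H.carrier_E)
    show "f \<in> hom G H.E" "inj_on f (carrier G)" "homeomorphic_map T (subtopology H.TE (f ` carrier G)) f"
      by (fact hom inj homeo)+
  qed
qed

theorem theorem4:
  fixes G :: "('a, 'b) monoid_scheme" and T :: "'a topology"
  assumes "topological_group G T"
    and "comm_group G"
    and "locally_compact_space T"
    and "sigma_compact_space T"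
  shows "\<exists>(E :: 'a points monoid) (T' :: 'a points topology).
           topological_group E T' \<and>
           locally_compact_space T' \<and>
           (Hausdorff_space T \<longrightarrow> Hausdorff_space T') \<and>
           duoseparable E T' \<and>
           abelian_by_countable E T' \<and>
           (\<exists>L. subgroup L E \<and>
             topologically_isomorphic G T (E\<lparr>carrier := L\<rparr>) (subtopology T' L))"
proof -
  interpret topological_comm_group G T
    using assms(1,2) by (rule topological_comm_group.intro)
  obtain E :: "(('a set \<times> (nat \<Rightarrow> 'a set)) \<times> ('a set \<times> (nat \<Rightarrow> 'a set) \<Rightarrow> 'a set \<times> (nat \<Rightarrow> 'a set))) monoid"
    and TE f where E: "topological_group E TE" "locally_compact_space TE" "Hausdorff_space T \<Longrightarrow> Hausdorff_space TE"
    "duoseparable E TE" "abelian_by_countable E TE" "countable (snd ` carrier E)"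
    and f: "f \<in> hom G E" "inj_on f (carrier G)" "homeomorphic_map T (subtopology TE (f ` carrier G)) f"
    by (rule embedding_into_semidirect[OF assms(3,4)]) blast
  interpret E: topological_group E TE by (rule E(1))
  \<comment> \<open>The \<open>M\<close>-coset takes index 0 and the sequence is shifted by one, so
    both fit into a single sequence of sets; the automorphism is replaced by its number in the
    countable set of second components.\<close>
  define \<phi> where "\<phi> z = encode (\<lambda>n. case n of 0 \<Rightarrow> fst (fst z) | Suc i \<Rightarrow> snd (fst z) i)
      (to_nat_on (snd ` carrier E) (snd z))"
    for z :: "('a set \<times> (nat \<Rightarrow> 'a set)) \<times> ('a set \<times> (nat \<Rightarrow> 'a set) \<Rightarrow> 'a set \<times> (nat \<Rightarrow> 'a set))"
  have "inj_on \<phi> (carrier E)"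
  proof (rule inj_onI)
    fix z w assume zw: "z \<in> carrier E" "w \<in> carrier E" "\<phi> z = \<phi> w"
    note inject = encode_inject[OF zw(3)[unfolded \<phi>_def]]
    have seq: "(case n of 0 \<Rightarrow> fst (fst z) | Suc i \<Rightarrow> snd (fst z) i) =
        (case n of 0 \<Rightarrow> fst (fst w) | Suc i \<Rightarrow> snd (fst w) i)" for n
      by (rule fun_cong[OF inject(1)])
    have "snd z = snd w" using inject(2) zw(1,2) E(6) by simp
    moreover have "fst (fst z) = fst (fst w)" using seq[of 0] by simp
    moreover have "snd (fst z) i = snd (fst w) i" for i using seq[of "Suc i"] by simp
    ultimately show "z = w" by (simp add: prod_eq_iff fun_eq_iff)
  qed
  then obtain E' :: "'a points monoid" and T'
    where E': "topological_group E' T'" and iso: "\<phi> \<in> iso E E'" and homeo: "homeomorphic_map TE T' \<phi>"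
    by (rule topological_group_transport[OF E(1)])
  interpret E': topological_group E' T' by (rule E')
  have \<phi>: "\<phi> \<in> hom E E'" "inj_on \<phi> (carrier E)" using iso by (auto simp: iso_def bij_betw_def)
  have fc: "f ` carrier G \<subseteq> carrier E" using f(1) by (auto simp: hom_def)
  define L where "L = (\<phi> \<circ> f) ` carrier G"
  have hom: "\<phi> \<circ> f \<in> hom G E'" by (rule Group.hom_compose[OF f(1) \<phi>(1)])
  interpret h: group_hom G E' "\<phi> \<circ> f"
    by (intro group_hom.intro is_group E'.is_group group_hom_axioms.intro hom)
  have inj: "inj_on (\<phi> \<circ> f) (carrier G)"
    by (rule comp_inj_on[OF f(2) inj_on_subset[OF \<phi>(2) fc]])
  have "homeomorphic_map (subtopology TE (f ` carrier G)) (subtopology T' L) \<phi>"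
    unfolding L_def image_comp[symmetric]
    by (rule homeomorphic_map_subtopologies[OF homeo])
      (use \<phi> fc in \<open>auto simp: E.topspace_eq_carrier E'.topspace_eq_carrier hom_def\<close>)
  from homeomorphic_map_compose[OF f(3) this]
  have "homeomorphic_map T (subtopology T' L) (\<phi> \<circ> f)" .
  moreover have "\<phi> \<circ> f \<in> iso G (E'\<lparr>carrier := L\<rparr>)"
    using hom inj by (auto simp: iso_def hom_def bij_betw_def L_def)
  ultimately have "topologically_isomorphic G T (E'\<lparr>carrier := L\<rparr>) (subtopology T' L)"
    unfolding topologically_isomorphic_def by blast
  moreover have "subgroup L E'" unfolding L_def by (rule h.img_is_subgroup)
  moreover have space: "TE homeomorphic_space T'"
    using homeo by (rule homeomorphic_map_imp_homeomorphic_space)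
  then have "locally_compact_space T'" using E(2) by (simp add: homeomorphic_locally_compact_space)
  moreover have "Hausdorff_space T \<longrightarrow> Hausdorff_space T'"
    using E(3) homeomorphic_Hausdorff_space[OF space] by blast
  moreover have "duoseparable E' T'" by (rule duoseparable_iso[OF E(1) E' iso homeo E(4)])
  moreover have "abelian_by_countable E' T'" by (rule abelian_by_countable_iso[OF E(1) E' iso homeo E(5)])
  ultimately show ?thesis using E' by (intro exI[of _ E'] exI[of _ T'] exI[of _ L] conjI)
qed

end
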